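(* Consider the $2\times2$ horizontal model described in the context. For a state $(\mathbf x,\mathbf y)$ let $z_1=x_1-y_1$, $z_2=y_2-x_2$ and $IB=z_1-z_2=x_1+x_2-y_1-y_2$. The optimal policy performs two rounds of matching in each period $t$. Round 1 (matching of perfect pairs): for $k=1,2$, match type $k$ demand with type $k$ supply greedily, i.e. $q_{kk}^t=\min\{x_k,y_k\}$. Round 2 (matching of an imperfect pair): (i) There is no matching in round 2 if $z_1z_2\le0$. (ii) If $z_1>0$ and $z_2>0$, match type 1 demand and type 2 supply. There exist protection levels $p_{d,+}^{t,IB}$ and $p_{s,+}^{t,IB}$ dependent on the imbalance $IB$, such that $p_{d,+}^{t,IB}-p_{s,+}^{t,IB}=IB$, and the matching between the pair $(1,2)$ reduces type 1 demand to $\min\{z_1,p_{d,+}^{t,IB}\}$ and type 2 supply to $\min\{z_2,p_{s,+}^{t,IB}\}$. (iii) If $z_1<0$ and $z_2<0$, match type 2 demand and type 1 supply. There exist protection levels $p_{d,-}^{t,IB}$ and $p_{s,-}^{t,IB}$ dependent on $IB$, such that $p_{d,-}^{t,IB}-p_{s,-}^{t,IB}=IB$, and the matching between the pair $(2,1)$ reduces type 2 demand to $\min\{-z_2,p_{d,-}^{t,IB}\}$ and type 1 supply to $\min\{-z_1,p_{s,-}^{t,IB}\}$.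
   Context: Model. $T\ge1$ is an integer, $\alpha,\beta\in[0,1]$ are the carry-over fractions of unmatched demand and supply, demand types $\mathcal D=\{1,2\}$, supply types $\mathcal S=\{1,2\}$, real unit matching rewards $r_{ij}^t$ ($1\le t\le T$), with the convention $r_{ij}^{T+1}=0$. In each period $t$ random vectors $\mathbf D^t,\mathbf S^t\in\mathbb R_+^2$ of new demand and supply arrive; their distributions do not depend on matching decisions. The state $(\mathbf x,\mathbf y)\in\mathbb R_+^2\times\mathbb R_+^2$ in period $t$ lists available quantities after the arrivals of period $t$. A feasible decision is $\mathbf Q=(q_{ij})\in\mathbb R_+^{2\times2}$ with $u_i=x_i-\sum_jq_{ij}\ge0$, $v_j=y_j-\sum_iq_{ij}\ge0$. Put $V_{T+1}\equiv0$ and for $t=T,\dots,1$ $$V_t(\mathbf x,\mathbf y)=\max_{\mathbf Q\text{ feasible}}\Big\{\sum_{i,j}r_{ij}^tq_{ij}+E\,V_{t+1}(\alpha\mathbf u+\mathbf D^{t+1},\beta\mathbf v+\mathbf S^{t+1})\Big\}.$$ A policy (a feasible decision for every $t$ and state) is optimal if it attains this maximum for every $t$ and every state. Horizontal $2\times 2$ model. Type 1 demand and type 1 supply share location 1, and type 2 demand and type 2 supply share location 2. For $k\in\{1,2\}$ write $-k=3-k$. It is assumed that for $k=1,2$ and all $t=1,\dots,T$: $r_{kk}^t\ge\max\{r_{k,-k}^t,r_{-k,k}^t\}$; and for all $i\in\mathcal D$, $j\in\mathcal S$: $r_{kk}^t-r_{k,-k}^t\ge r_{ik}^{t+1}-r_{i,-k}^{t+1}$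 and $r_{kk}^t-r_{-k,k}^t\ge r_{kj}^{t+1}-r_{-k,j}^{t+1}$.
   Formalization: Added: max(α,β)·r_kk^{t+1} ≤ r_kk^t for k=1,2 and all t≤T; without it waiting can beat greedy matching (T=2, α=β=1, no arrivals, r^1=0, r^2=10). Protection levels may both be +∞ (imperfect pair never matched), then p_d−p_s=IB is void. Arrivals are integrable. *)

theory Defs
  imports "HOL-Probability.Probability"
begin

text \<open>
  Indices range over the two-element numeral type \<^typ>\<open>2\<close>, whose elements are 1 and 2.
  Arithmetic there is modulo 2, so \<open>3 - k\<close> is the index other than \<open>k\<close>.
  The entry \<open>Q $ i $ j\<close> is the quantity of type \<open>i\<close> demand matched with type \<open>j\<close> supply.
\<close>

definition unmatched_demand :: "real^2 \<Rightarrow> real^2^2 \<Rightarrow> real^2" where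
  "unmatched_demand x Q = (\<chi> i. x $ i - (\<Sum>j\<in>UNIV. Q $ i $ j))"

definition unmatched_supply :: "real^2 \<Rightarrow> real^2^2 \<Rightarrow> real^2" where
  "unmatched_supply y Q = (\<chi> j. y $ j - (\<Sum>i\<in>UNIV. Q $ i $ j))"

definition is_state :: "real^2 \<Rightarrow> real^2 \<Rightarrow> bool" where
  "is_state x y \<longleftrightarrow> (\<forall>i. 0 \<le> x $ i) \<and> (\<forall>j. 0 \<le> y $ j)"

definition feasible :: "real^2 \<Rightarrow> real^2 \<Rightarrow> real^2^2 \<Rightarrow> bool" where
  "feasible x y Q \<longleftrightarrow>
     (\<forall>i j. 0 \<le> Q $ i $ j) \<and>
     (\<forall>i. 0 \<le> unmatched_demand x Q $ i) \<and> (\<forall>j. 0 \<le> unmatched_supply y Q $ j)"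

text \<open>
  The expectation in the recursion is unconditional, so only the joint law of \<open>D t\<close> and \<open>S t\<close>
  for each single \<open>t\<close> matters. Demand and supply of a period may be dependent, and no assumption
  is made across periods. Integrability of the arrivals makes the expectations finite.
  The arrivals of period \<open>Suc T\<close> are unconstrained: they only enter the zero terminal value.
\<close>

locale matching_model = prob_space M for M :: "'m measure" +
  fixes T :: nat
    and \<alpha> \<beta> :: real
    and r :: "nat \<Rightarrow> real^2^2"
    and D S :: "nat \<Rightarrow> 'm \<Rightarrow> real^2"
  assumes T_ge_1: "1 \<le> T"
    and alpha_range: "\<alpha> \<in> {0..1}"
    and beta_range: "\<beta> \<in> {0..1}"
    and reward_terminal: "r (Suc T) = 0"
    and D_integrable: "\<And>t. t \<in> {1..T} \<Longrightarrow> integrable M (D t)"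
    and S_integrable: "\<And>t. t \<in> {1..T} \<Longrightarrow> integrable M (S t)"
    and arrivals_nonneg: "\<And>t \<omega>. t \<in> {1..T} \<Longrightarrow> \<omega> \<in> space M \<Longrightarrow> is_state (D t \<omega>) (S t \<omega>)"
begin

definition objective ::
  "(real^2 \<Rightarrow> real^2 \<Rightarrow> real) \<Rightarrow> nat \<Rightarrow> real^2 \<Rightarrow> real^2 \<Rightarrow> real^2^2 \<Rightarrow> real" where
  "objective W t x y Q =
     (\<Sum>i\<in>UNIV. \<Sum>j\<in>UNIV. r t $ i $ j * Q $ i $ j) +
     expectation (\<lambda>\<omega>. W (\<alpha> *\<^sub>R unmatched_demand x Q + D (Suc t) \<omega>)
                         (\<beta> *\<^sub>R unmatched_supply y Q + S (Suc t) \<omega>))"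

function V :: "nat \<Rightarrow> real^2 \<Rightarrow> real^2 \<Rightarrow> real" where
  "V t = (if T < t then (\<lambda>x y. 0)
          else (\<lambda>x y. SUP Q\<in>{Q. feasible x y Q}. objective (V (Suc t)) t x y Q))"
  by auto
termination by (relation "Wellfounded.measure (\<lambda>t. Suc T - t)") auto

declare V.simps [simp del]

definition optimal_policy :: "(nat \<Rightarrow> real^2 \<Rightarrow> real^2 \<Rightarrow> real^2^2) \<Rightarrow> bool" where
  "optimal_policy Q \<longleftrightarrow>
     (\<forall>t\<in>{1..T}. \<forall>x y. is_state x y \<longrightarrow>
        is_arg_max (objective (V (Suc t)) t x y) (feasible x y) (Q t x y))"

end

locale horizontal_model = matching_model M T \<alpha> \<beta> r D S
  for M :: "'m measure" and T :: nat and \<alpha> \<beta> :: real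
    and r :: "nat \<Rightarrow> real^2^2" and D S :: "nat \<Rightarrow> 'm \<Rightarrow> real^2" +
  assumes perfect_pair:
      "\<And>t k. t \<in> {1..T} \<Longrightarrow> max (r t $ k $ (3 - k)) (r t $ (3 - k) $ k) \<le> r t $ k $ k"
    and supply_exchange:
      "\<And>t k i. t \<in> {1..T} \<Longrightarrow>
         r (Suc t) $ i $ k - r (Suc t) $ i $ (3 - k) \<le> r t $ k $ k - r t $ k $ (3 - k)"
    and demand_exchange:
      "\<And>t k j. t \<in> {1..T} \<Longrightarrow>
         r (Suc t) $ k $ j - r (Suc t) $ (3 - k) $ j \<le> r t $ k $ k - r t $ (3 - k) $ k"

text \<open>
  The assumptions of \<open>horizontal_model\<close> do not bound the growth of the rewards over time, and
  greedy matching of perfect pairs can be suboptimal when waiting pays more than matching now.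
  The following condition excludes this. It implies nonnegative rewards for perfect pairs, and it
  is sharp: a violation for a given \<open>t\<close> and \<open>k\<close> makes greedy matching suboptimal for suitable
  arrivals.
\<close>

definition waiting_not_profitable :: "nat \<Rightarrow> real \<Rightarrow> real \<Rightarrow> (nat \<Rightarrow> real^2^2) \<Rightarrow> bool" where
  "waiting_not_profitable T \<alpha> \<beta> r \<longleftrightarrow>
     (\<forall>t\<in>{1..T}. \<forall>k. max \<alpha> \<beta> * r (Suc t) $ k $ k \<le> r t $ k $ k)"

definition excess_demand1 :: "real^2 \<Rightarrow> real^2 \<Rightarrow> real" where
  "excess_demand1 x y = x $ 1 - y $ 1"

definition excess_supply2 :: "real^2 \<Rightarrow> real^2 \<Rightarrow> real" where
  "excess_supply2 x y = y $ 2 - x $ 2"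

text \<open>
  The protection levels for a given imbalance apply to states of unbounded size, so they are
  infinite when the imperfect pair is never worth matching (for instance if its reward is
  negative). The difference of the levels is then of the undetermined form
  \<open>\<infinity> - \<infinity>\<close>, and no further condition is imposed.
\<close>

definition protection_levels :: "ereal \<Rightarrow> ereal \<Rightarrow> real \<Rightarrow> bool" where
  "protection_levels pd ps IB \<longleftrightarrow>
     (pd = \<infinity> \<and> ps = \<infinity>) \<or> (\<exists>a b. pd = ereal a \<and> ps = ereal b \<and> a - b = IB)"

end

theory Submission
  imports Defs
begin

text \<open>
  Only the leftovers of a period matter for the future, so the decision of period \<open>t\<close> maximizes
  \<open>reward (r t) Q + G u v\<close>, where \<open>u\<close> and \<open>v\<close> are the unmatched quantities and \<open>G\<close> is the
  expected value of carrying them over. Three bounds on \<open>G\<close> make round 1 optimal: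
  \<^item> holding type \<open>k\<close> demand rather than demand of the other type is worth at most
    \<open>r t $ k $ k - r t $ (3 - k) $ k\<close> per unit;
  \<^item> holding type \<open>k\<close> supply rather than supply of the other type is worth at most
    \<open>r t $ k $ k - r t $ k $ (3 - k)\<close> per unit;
  \<^item> holding a further perfect pair of type \<open>k\<close> is worth at most \<open>r t $ k $ k\<close> per unit.

  As long as the pair \<open>(k, k)\<close> is not matched greedily, one of the following changes applies and,
  by these bounds, costs nothing: replace matches of both imperfect pairs by matches of both
  perfect pairs, redirect type \<open>k\<close> supply or demand from an imperfect match to an unmatched perfect
  partner, or match an unmatched perfect pair. This is \<open>ex_greedy_improvement\<close>.

  The bounds pass from each period to the preceding one. For the exchange bounds, a state with
  type \<open>k\<close> demand replaced by the other type can imitate the decision of the original state. This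
  loses a difference of rewards on the quantity that is matched and the exchange bound of the next
  period on the quantity that is not, and the assumptions on the growth of reward differences
  control both. The bound for pairs follows from greedy matching itself: a further perfect pair can
  be assumed to be matched at once, so it is worth at most \<open>r t $ k $ k\<close> in period \<open>t\<close>; seen from
  the preceding period at most the fraction \<open>max \<alpha> \<beta>\<close> of it survives, and it is then covered by the
  condition that waiting is not profitable. Monotonicity, Lipschitz continuity and concavity of the
  value function are carried along (\<open>regular_value\<close>, \<open>regular_bellman\<close>, \<open>regular_expected\<close>).
  Continuity makes the maxima attained and the expectations meaningful.

  After round 1 the only freedom left is the quantity matched in a single imperfect pair
  \<open>(k, 3 - k)\<close>. If \<open>s\<close> is the type \<open>k\<close> demand that remains, then \<open>s - IB\<close> is the remaining supply of
  the other type, so the value of the decision is a constant plus a concave function of \<open>s\<close> that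
  depends on the state only through \<open>IB\<close>. A maximizer of this function is the protection level.
  A concave function without a maximizer is increasing, and then the level is infinite.
\<close>

section \<open>Matchings between two demand and two supply types\<close>

lemma other_index [simp]: "(3::2) - k \<noteq> k" "k \<noteq> (3::2) - k" "(3::2) - (3 - k) = k"
  using exhaust_2[of k] by auto

lemma all_index_iff: "(\<forall>i::2. P i) \<longleftrightarrow> P k \<and> P (3 - k)"
  using exhaust_2[of k] by (auto simp: forall_2)

lemma sum_index: "(\<Sum>i\<in>(UNIV::2 set). f i) = f k + (f (3 - k) :: real)"
  using exhaust_2[of k] by (auto simp: sum_2)

text \<open>
  Every change of a matching is written as a sum of terms \<open>axis i (axis j c)\<close>: the quantity
  matched in the pair \<open>(i, j)\<close> grows by \<open>c\<close>, which may be negative. Feasibility then reduces to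
  nonnegative entries and a nonnegative pair of leftovers.
\<close>

lemma axis_nth_if: "axis i (c::'b::zero) $ j = (if j = i then c else 0)"
  by (auto simp: axis_def)

definition reward :: "real^2^2 \<Rightarrow> real^2^2 \<Rightarrow> real" where
  "reward R Q = (\<Sum>i\<in>UNIV. \<Sum>j\<in>UNIV. R $ i $ j * Q $ i $ j)"

lemma reward_rematch: "reward R (Q + axis i (axis j c)) = reward R Q + R $ i $ j * c"
  using exhaust_2[of i] exhaust_2[of j]
  by (auto simp: reward_def sum_2 axis_nth_if distrib_left)

lemma reward_combination: "reward R (a *\<^sub>R Q + b *\<^sub>R Q') = a * reward R Q + b * reward R Q'"
  by (simp add: reward_def sum_2 algebra_simps)

lemma unmatched_demand_rematch:
  "unmatched_demand x (Q + axis i (axis j c)) = unmatched_demand x Q + axis i (- c)"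
  by (simp add: vec_eq_iff unmatched_demand_def all_index_iff[of _ i] sum_index[of _ j] axis_nth_if)

lemma unmatched_supply_rematch:
  "unmatched_supply y (Q + axis i (axis j c)) = unmatched_supply y Q + axis j (- c)"
  by (simp add: vec_eq_iff unmatched_supply_def all_index_iff[of _ j] sum_index[of _ i] axis_nth_if)

lemma unmatched_demand_add: "unmatched_demand (x + z) Q = unmatched_demand x Q + z"
  by (simp add: vec_eq_iff unmatched_demand_def)

lemma unmatched_supply_add: "unmatched_supply (y + z) Q = unmatched_supply y Q + z"
  by (simp add: vec_eq_iff unmatched_supply_def)

lemma unmatched_demand_nth: "unmatched_demand x Q $ k = x $ k - Q $ k $ k - Q $ k $ (3 - k)"
  by (simp add: unmatched_demand_def sum_index[of _ k])

lemma unmatched_supply_nth: "unmatched_supply y Q $ k = y $ k - Q $ k $ k - Q $ (3 - k) $ k"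
  by (simp add: unmatched_supply_def sum_index[of _ k])

lemma feasible_iff:
  "feasible x y Q \<longleftrightarrow>
     (\<forall>i j. 0 \<le> Q $ i $ j) \<and> is_state (unmatched_demand x Q) (unmatched_supply y Q)"
  by (simp add: feasible_def is_state_def)

lemma is_state_iff:
  "is_state x y \<longleftrightarrow> 0 \<le> x $ k \<and> 0 \<le> x $ (3 - k) \<and> 0 \<le> y $ k \<and> 0 \<le> y $ (3 - k)"
  by (simp add: is_state_def all_index_iff[of _ k])

lemma feasible_iff_index:
  "feasible x y Q \<longleftrightarrow>
     0 \<le> Q $ k $ k \<and> 0 \<le> Q $ k $ (3 - k) \<and> 0 \<le> Q $ (3 - k) $ k \<and> 0 \<le> Q $ (3 - k) $ (3 - k) \<and>
     Q $ k $ k + Q $ k $ (3 - k) \<le> x $ k \<and>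
     Q $ (3 - k) $ k + Q $ (3 - k) $ (3 - k) \<le> x $ (3 - k) \<and>
     Q $ k $ k + Q $ (3 - k) $ k \<le> y $ k \<and>
     Q $ k $ (3 - k) + Q $ (3 - k) $ (3 - k) \<le> y $ (3 - k)"
  by (auto simp: feasible_iff is_state_iff[of _ _ k] all_index_iff[of _ k]
      unmatched_demand_nth unmatched_supply_nth algebra_simps)

lemma is_state_commute: "is_state y x \<longleftrightarrow> is_state x y"
  by (auto simp: is_state_def)

lemma transpose_nth: "transpose Q $ i $ j = Q $ j $ i"
  by (simp add: transpose_def)

text \<open>
  Exchanging the roles of demand and supply amounts to transposing matchings and rewards. Every
  fact about demand proved below yields the corresponding fact about supply in this way.
\<close>

lemma unmatched_transpose [simp]:
  "unmatched_demand y (transpose Q) = unmatched_supply y Q"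
  "unmatched_supply x (transpose Q) = unmatched_demand x Q"
  by (simp_all add: vec_eq_iff unmatched_demand_def unmatched_supply_def transpose_nth)

lemma feasible_transpose [simp]: "feasible y x (transpose Q) \<longleftrightarrow> feasible x y Q"
  by (auto simp: feasible_iff is_state_commute transpose_nth)

lemma reward_transpose [simp]: "reward (transpose R) (transpose Q) = reward R Q"
  by (simp add: reward_def sum_2 transpose_nth)

lemma feasible_zero: "is_state x y \<Longrightarrow> feasible x y 0"
  by (simp add: feasible_iff is_state_def unmatched_demand_def unmatched_supply_def)

lemma unmatched_combination:
  "unmatched_demand (a *\<^sub>R x + b *\<^sub>R x') (a *\<^sub>R Q + b *\<^sub>R Q')
    = a *\<^sub>R unmatched_demand x Q + b *\<^sub>R unmatched_demand x' Q'"
  "unmatched_supply (a *\<^sub>R y + b *\<^sub>R y') (a *\<^sub>R Q + b *\<^sub>R Q')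
    = a *\<^sub>R unmatched_supply y Q + b *\<^sub>R unmatched_supply y' Q'"
  by (simp_all add: vec_eq_iff unmatched_demand_def unmatched_supply_def sum_2 algebra_simps)

lemma feasible_combination:
  assumes "feasible x y Q" "feasible x' y' Q'" "0 \<le> a" "0 \<le> b"
  shows "feasible (a *\<^sub>R x + b *\<^sub>R x') (a *\<^sub>R y + b *\<^sub>R y') (a *\<^sub>R Q + b *\<^sub>R Q')"
  using assms by (simp add: feasible_iff is_state_def unmatched_combination)

lemma compact_feasible: "compact {Q. feasible x y Q}"
proof -
  have "continuous_on UNIV (\<lambda>Q. unmatched_demand x Q)"
    "continuous_on UNIV (\<lambda>Q. unmatched_supply y Q)"
    unfolding unmatched_demand_def unmatched_supply_def by (auto intro!: continuous_intros)
  then have "closed {Q. feasible x y Q}"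
    unfolding feasible_def
    by (intro closed_Collect_conj closed_Collect_all closed_Collect_le continuous_intros) auto
  moreover have "norm Q \<le> 4 * (x $ 1 + x $ 2)" if "feasible x y Q" for Q
  proof -
    have "norm Q \<le> norm (Q $ 1) + norm (Q $ 2)"
      using L2_set_le_sum[of UNIV "\<lambda>i. norm (Q $ i)"] by (simp add: norm_vec_def sum_2)
    also have "norm (Q $ i) \<le> \<bar>Q $ i $ 1\<bar> + \<bar>Q $ i $ 2\<bar>" for i
      using norm_le_l1_cart[of "Q $ i"] by (simp add: sum_2)
    then have "norm (Q $ 1) + norm (Q $ 2)
        \<le> (\<bar>Q $ 1 $ 1\<bar> + \<bar>Q $ 1 $ 2\<bar>) + (\<bar>Q $ 2 $ 1\<bar> + \<bar>Q $ 2 $ 2\<bar>)"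
      by (intro add_mono)
    also have "\<dots> \<le> 4 * (x $ 1 + x $ 2)"
      using that by (simp add: feasible_iff_index[of _ _ _ 1])
    finally show ?thesis .
  qed
  then have "bounded {Q. feasible x y Q}"
    unfolding bounded_iff by auto
  ultimately show ?thesis by (simp add: compact_eq_bounded_closed)
qed

text \<open>
  The arrivals are hidden in the continuation value \<open>G\<close>, a function of the quantities left
  unmatched, so the problem of one period is deterministic.
\<close>

definition stage_value ::
  "real^2^2 \<Rightarrow> (real^2 \<Rightarrow> real^2 \<Rightarrow> real) \<Rightarrow> real^2 \<Rightarrow> real^2 \<Rightarrow> real^2^2 \<Rightarrow> real" where
  "stage_value R G x y Q = reward R Q + G (unmatched_demand x Q) (unmatched_supply y Q)"

definition bellman ::
  "real^2^2 \<Rightarrow> (real^2 \<Rightarrow> real^2 \<Rightarrow> real) \<Rightarrow> real^2 \<Rightarrow> real^2 \<Rightarrow> real" where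
  "bellman R G x y = (SUP Q\<in>{Q. feasible x y Q}. stage_value R G x y Q)"

lemma stage_value_transpose [simp]:
  "stage_value (transpose R) (\<lambda>x y. G y x) y x (transpose Q) = stage_value R G x y Q"
  by (simp add: stage_value_def)

lemma bellman_transpose:
  "bellman (transpose R) (\<lambda>x y. G y x) y x = bellman R G x y"
proof -
  have "{Q. feasible y x Q} = transpose ` {Q. feasible x y Q}"
    by (auto simp: image_iff) (metis feasible_transpose transpose_transpose)
  then show ?thesis by (simp add: bellman_def image_comp o_def)
qed

section \<open>Regular value functions\<close>

text \<open>
  The properties that value functions and continuation values share. The constants bound marginal
  values: \<open>c k\<close> that of exchanging a unit of demand of the other type for type \<open>k\<close>, \<open>d k\<close> the
  same for supply, and \<open>p k\<close> that of a further unit of both type \<open>k\<close> demand and type \<open>k\<close> supply.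
  Monotonicity and the Lipschitz bound are required along coordinate directions only, since these
  are the changes that the proofs perform on states.
\<close>

locale regular_value =
  fixes W :: "real^2 \<Rightarrow> real^2 \<Rightarrow> real" and L :: real and c d p :: "2 \<Rightarrow> real"
  assumes demand_mono: "\<And>x y k w. is_state x y \<Longrightarrow> 0 \<le> w \<Longrightarrow> W x y \<le> W (x + axis k w) y"
    and demand_lipschitz:
      "\<And>x y k w. is_state x y \<Longrightarrow> 0 \<le> w \<Longrightarrow> W (x + axis k w) y \<le> W x y + L * w"
    and demand_exchange: "\<And>x y k w. is_state x y \<Longrightarrow> 0 \<le> w \<Longrightarrow>
      W (x + axis k w) y \<le> W (x + axis (3 - k) w) y + c k * w"
    and supply_mono: "\<And>x y k w. is_state x y \<Longrightarrow> 0 \<le> w \<Longrightarrow> W x y \<le> W x (y + axis k w)"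
    and supply_lipschitz:
      "\<And>x y k w. is_state x y \<Longrightarrow> 0 \<le> w \<Longrightarrow> W x (y + axis k w) \<le> W x y + L * w"
    and supply_exchange: "\<And>x y k w. is_state x y \<Longrightarrow> 0 \<le> w \<Longrightarrow>
      W x (y + axis k w) \<le> W x (y + axis (3 - k) w) + d k * w"
    and pair_bound: "\<And>x y k w. is_state x y \<Longrightarrow> 0 \<le> w \<Longrightarrow>
      W (x + axis k w) (y + axis k w) \<le> W x y + p k * w"
    and concave: "\<And>x y x' y' a b. is_state x y \<Longrightarrow> is_state x' y' \<Longrightarrow> 0 \<le> a \<Longrightarrow> 0 \<le> b \<Longrightarrow> a + b = 1 \<Longrightarrow>
      a * W x y + b * W x' y' \<le> W (a *\<^sub>R x + b *\<^sub>R x') (a *\<^sub>R y + b *\<^sub>R y')"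
begin

lemma swap: "regular_value (\<lambda>x y. W y x) L d c p"
  by unfold_locales
    (blast intro: demand_mono demand_lipschitz demand_exchange supply_mono supply_lipschitz
      supply_exchange pair_bound concave is_state_commute[THEN iffD1])+

lemma lipschitz_const_nonneg: "0 \<le> L"
  using demand_mono[of 0 0 1 1] demand_lipschitz[of 0 0 1 1] by (simp add: is_state_def)

lemma increase_bounds:
  assumes "is_state x y" "0 \<le> a" "0 \<le> b" "0 \<le> a'" "0 \<le> b'"
  shows "W x y \<le> W (x + axis 1 a + axis 2 b) (y + axis 1 a' + axis 2 b')"
    and "W (x + axis 1 a + axis 2 b) (y + axis 1 a' + axis 2 b') \<le> W x y + L * (a + b + a' + b')"
proof -
  have st: "is_state (x + axis 1 a) y" "is_state (x + axis 1 a + axis 2 b) y"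
    "is_state (x + axis 1 a + axis 2 b) (y + axis 1 a')"
    using assms by (auto simp: is_state_def axis_nth_if)
  show "W x y \<le> W (x + axis 1 a + axis 2 b) (y + axis 1 a' + axis 2 b')"
    using demand_mono[OF assms(1,2), of 1] demand_mono[OF st(1) assms(3), of 2]
      supply_mono[OF st(2) assms(4), of 1] supply_mono[OF st(3) assms(5), of 2] by linarith
  show "W (x + axis 1 a + axis 2 b) (y + axis 1 a' + axis 2 b') \<le> W x y + L * (a + b + a' + b')"
    using demand_lipschitz[OF assms(1,2), of 1] demand_lipschitz[OF st(1) assms(3), of 2]
      supply_lipschitz[OF st(2) assms(4), of 1] supply_lipschitz[OF st(3) assms(5), of 2]
    by (simp add: algebra_simps)
qed

text \<open>
  Both states lie below their componentwise maximum; one passes up to it by monotonicity and back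
  down by the Lipschitz bounds.
\<close>

lemma difference_bound:
  assumes "is_state x y" "is_state x' y'"
  shows "W x y - W x' y' \<le>
    L * (\<bar>x $ 1 - x' $ 1\<bar> + \<bar>x $ 2 - x' $ 2\<bar> + \<bar>y $ 1 - y' $ 1\<bar> + \<bar>y $ 2 - y' $ 2\<bar>)"
proof -
  \<comment> \<open>\<open>f u v\<close> is the componentwise maximum of \<open>u\<close> and \<open>v\<close>, reached from \<open>u\<close> by the increments \<open>e u v\<close>.\<close>
  define e f where "e u v i = max 0 (v $ i - u $ i)" and "f u v = u + axis 1 (e u v 1) + axis 2 (e u v 2)"
    for u v :: "real^2" and i
  have e: "0 \<le> e u v i" "e u v i \<le> \<bar>v $ i - u $ i\<bar>" for u v i
    by (auto simp: e_def)
  have f: "f u v = f v u" for u v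
    by (auto simp: f_def e_def vec_eq_iff forall_2 axis_nth_if)
  have "W x y \<le> W (f x x') (f y y')"
    unfolding f_def using e assms by (intro increase_bounds) auto
  also have "\<dots> = W (f x' x) (f y' y)" by (simp add: f)
  also have "\<dots> \<le> W x' y' + L * (e x' x 1 + e x' x 2 + e y' y 1 + e y' y 2)"
    unfolding f_def using e assms by (intro increase_bounds) auto
  also have "\<dots> \<le> W x' y' +
      L * (\<bar>x $ 1 - x' $ 1\<bar> + \<bar>x $ 2 - x' $ 2\<bar> + \<bar>y $ 1 - y' $ 1\<bar> + \<bar>y $ 2 - y' $ 2\<bar>)"
    by (intro add_left_mono mult_left_mono add_mono e lipschitz_const_nonneg)
  finally show ?thesis by simp
qed

lemma growth_bound:
  assumes "is_state x y"
  shows "\<bar>W x y\<bar> \<le> \<bar>W 0 0\<bar> + L * (2 * norm x + 2 * norm y)"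
proof -
  have z: "is_state 0 0" by (simp add: is_state_def)
  have "\<bar>x $ 1\<bar> + \<bar>x $ 2\<bar> + \<bar>y $ 1\<bar> + \<bar>y $ 2\<bar> \<le> 2 * norm x + 2 * norm y"
    using component_le_norm_cart[of x 1] component_le_norm_cart[of x 2]
      component_le_norm_cart[of y 1] component_le_norm_cart[of y 2] by linarith
  from mult_left_mono[OF this lipschitz_const_nonneg]
    difference_bound[OF assms z] difference_bound[OF z assms]
  show ?thesis by simp linarith
qed

lemma continuous_on_states: "continuous_on {(x, y). is_state x y} (\<lambda>(x, y). W x y)"
proof -
  have *: "W x y - W x' y' \<le> 4 * L * dist (x, y) (x', y')"
    if "is_state x y" "is_state x' y'" for x y x' y'
  proof -
    have bound: "\<bar>x $ i - x' $ i\<bar> \<le> dist (x, y) (x', y')"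
      "\<bar>y $ i - y' $ i\<bar> \<le> dist (x, y) (x', y')" for i
      using component_le_norm_cart[of "x - x'" i] component_le_norm_cart[of "y - y'" i]
        dist_fst_le[of "(x, y)" "(x', y')"] dist_snd_le[of "(x, y)" "(x', y')"]
      by (auto simp: dist_norm)
    have "\<bar>x $ 1 - x' $ 1\<bar> + \<bar>x $ 2 - x' $ 2\<bar> + \<bar>y $ 1 - y' $ 1\<bar> + \<bar>y $ 2 - y' $ 2\<bar>
        \<le> 4 * dist (x, y) (x', y')"
      using bound(1)[of 1] bound(1)[of 2] bound(2)[of 1] bound(2)[of 2] by linarith
    from mult_left_mono[OF this lipschitz_const_nonneg] difference_bound[OF that]
    show ?thesis by (simp add: algebra_simps)
  qed
  have "\<bar>W x y - W x' y'\<bar> \<le> 4 * L * dist (x, y) (x', y')"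
    if "is_state x y" "is_state x' y'" for x y x' y'
    using *[OF that] *[OF that(2,1)] by (simp add: dist_commute abs_le_iff)
  then have "(4 * L)-lipschitz_on {(x, y). is_state x y} (\<lambda>(x, y). W x y)"
    using lipschitz_const_nonneg by (intro lipschitz_onI) (auto simp: dist_real_def)
  then show ?thesis by (rule lipschitz_on_continuous_on)
qed

lemma continuous_on_compose:
  assumes "continuous_on S f" "continuous_on S g" "\<And>s. s \<in> S \<Longrightarrow> is_state (f s) (g s)"
  shows "continuous_on S (\<lambda>s. W (f s) (g s))"
  using continuous_on_compose2[OF continuous_on_states continuous_on_Pair[OF assms(1,2)]] assms(3)
  by auto

lemma ex_max_stage_value:
  assumes "is_state x y"
  obtains Q where "feasible x y Q" "\<And>Q'. feasible x y Q' \<Longrightarrow> stage_value R W x y Q' \<le> stage_value R W x y Q"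
proof -
  have "continuous_on {Q. feasible x y Q} (stage_value R W x y)"
    unfolding stage_value_def reward_def
    by (intro continuous_intros continuous_on_compose)
      (auto simp: unmatched_demand_def unmatched_supply_def feasible_iff intro!: continuous_intros)
  moreover have "{Q. feasible x y Q} \<noteq> {}"
    using feasible_zero[OF assms] by auto
  ultimately show ?thesis
    using that continuous_attains_sup[OF compact_feasible] by blast
qed

text \<open>
  A supremum of reals is an upper bound only if the set is bounded; here the maximum exists by
  compactness of the feasible set.
\<close>

lemma stage_value_le_bellman:
  assumes "is_state x y" "feasible x y Q"
  shows "stage_value R W x y Q \<le> bellman R W x y"
  unfolding bellman_def
proof (rule cSUP_upper)
  show "bdd_above (stage_value R W x y ` {Q. feasible x y Q})"
    using ex_max_stage_value[OF assms(1), of R] by (metis bdd_aboveI2 mem_Collect_eq)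
qed (use assms in simp)

lemma bellman_leI:
  assumes "is_state x y" "\<And>Q. feasible x y Q \<Longrightarrow> stage_value R W x y Q \<le> B"
  shows "bellman R W x y \<le> B"
  unfolding bellman_def using assms feasible_zero[OF assms(1)] by (intro cSUP_least) auto

lemma bellman_attained:
  assumes "is_state x y"
  obtains Q where "feasible x y Q" "stage_value R W x y Q = bellman R W x y"
  using ex_max_stage_value[OF assms, of R] stage_value_le_bellman[OF assms, of _ R]
    bellman_leI[OF assms, of R] by (metis order_antisym)

end

section \<open>Greedy matching of perfect pairs\<close>

lemmas rematch_simps = unmatched_demand_rematch unmatched_supply_rematch reward_rematch
  unmatched_demand_add unmatched_supply_add

text \<open>
  The conditions under which greedy matching of perfect pairs loses nothing: the rewards of the
  present period dominate the marginal values of waiting, and two perfect matches are worth at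
  least as much as two imperfect ones.
\<close>

locale greedy_stage = regular_value G L c d p for G L c d p +
  fixes R :: "real^2^2"
  assumes redirect_demand: "\<And>k. c k \<le> R $ k $ k - R $ (3 - k) $ k"
    and redirect_supply: "\<And>k. d k \<le> R $ k $ k - R $ k $ (3 - k)"
    and pair_worth: "\<And>k. p k \<le> R $ k $ k"
    and perfect_sum: "\<And>k. R $ k $ (3 - k) + R $ (3 - k) $ k \<le> R $ k $ k + R $ (3 - k) $ (3 - k)"
begin

abbreviation val where "val \<equiv> stage_value R G"

lemma swap_stage: "greedy_stage (\<lambda>x y. G y x) L d c p (transpose R)"
proof -
  interpret sw: regular_value "\<lambda>x y. G y x" L d c p by (rule swap)
  show ?thesis
    by unfold_locales
      (use redirect_demand redirect_supply pair_worth perfect_sum in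
        \<open>simp_all add: transpose_nth add.commute\<close>)
qed

text \<open>
  Both types are made greedy one after the other, so changes made for type \<open>k\<close> must not reduce what
  is already matched in the other perfect pair.
\<close>

definition improves :: "2 \<Rightarrow> real^2 \<Rightarrow> real^2 \<Rightarrow> real^2^2 \<Rightarrow> real^2^2 \<Rightarrow> bool" where
  "improves k x y Q Q' \<longleftrightarrow> feasible x y Q' \<and> val x y Q \<le> val x y Q' \<and>
     Q $ (3 - k) $ (3 - k) \<le> Q' $ (3 - k) $ (3 - k)"

lemma improves_trans: "improves k x y Q Q' \<Longrightarrow> improves k x y Q' Q'' \<Longrightarrow> improves k x y Q Q''"
  unfolding improves_def by linarith

text \<open>
  Matching \<open>w\<close> units now earns \<open>R $ k $ k\<close> per unit, and keeping them as a pair for the future is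
  worth at most \<open>p k\<close> per unit.
\<close>

lemma improve_pair:
  assumes Q: "feasible x y Q" and w: "0 \<le> w"
    and le: "w \<le> unmatched_demand x Q $ k" "w \<le> unmatched_supply y Q $ k"
  shows "improves k x y Q (Q + axis k (axis k w))" (is "improves k x y Q ?Q")
proof -
  let ?u = "unmatched_demand x Q + axis k (- w)" and ?v = "unmatched_supply y Q + axis k (- w)"
  have st: "is_state ?u ?v"
    using Q w le by (auto simp: feasible_iff is_state_def axis_nth_if)
  have restore: "?u + axis k w = unmatched_demand x Q" "?v + axis k w = unmatched_supply y Q"
    by (simp_all add: vec_eq_iff axis_nth_if)
  have f: "feasible x y ?Q"
    using Q w st by (auto simp: feasible_iff rematch_simps axis_nth_if)
  have "p k * w \<le> R $ k $ k * w"
    using pair_worth w by (rule mult_right_mono)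
  with pair_bound[OF st w, of k, unfolded restore] have "val x y Q \<le> val x y ?Q"
    by (simp add: stage_value_def rematch_simps)
  with f show ?thesis by (simp add: improves_def axis_nth_if)
qed

text \<open>
  Type \<open>k\<close> supply serves \<open>w\<close> units of type \<open>k\<close> demand in place of the other type, so that type
  \<open>3 - k\<close> demand waits where type \<open>k\<close> demand did. The gain in reward per unit is at least the
  exchange bound \<open>c k\<close> that limits the loss in the future.
\<close>

lemma improve_redirect_demand:
  assumes Q: "feasible x y Q" and w: "0 \<le> w"
    and le: "w \<le> unmatched_demand x Q $ k" "w \<le> Q $ (3 - k) $ k"
  shows "improves k x y Q (Q + axis k (axis k w) + axis (3 - k) (axis k (- w)))"
    (is "improves k x y Q ?Q")
proof -
  let ?u = "unmatched_demand x Q + axis k (- w)"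
  have st: "is_state ?u (unmatched_supply y Q)"
    using Q w le by (auto simp: feasible_iff is_state_def axis_nth_if)
  have eq: "?u + axis k w = unmatched_demand x Q"
    "unmatched_demand x ?Q = ?u + axis (3 - k) w" "unmatched_supply y ?Q = unmatched_supply y Q"
    by (simp_all add: rematch_simps vec_eq_iff axis_nth_if)
  have f: "feasible x y ?Q"
    using Q w st le(2) unfolding feasible_iff eq by (auto simp: is_state_def axis_nth_if)
  have "c k * w \<le> (R $ k $ k - R $ (3 - k) $ k) * w"
    using redirect_demand w by (rule mult_right_mono)
  with demand_exchange[OF st w, of k, unfolded eq(1)] have "val x y Q \<le> val x y ?Q"
    unfolding stage_value_def eq reward_rematch by (simp add: algebra_simps)
  with f show ?thesis by (simp add: improves_def axis_nth_if)
qed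

lemma improve_redirect_supply:
  assumes Q: "feasible x y Q" and w: "0 \<le> w"
    and le: "w \<le> unmatched_supply y Q $ k" "w \<le> Q $ k $ (3 - k)"
  shows "improves k x y Q (Q + axis k (axis k w) + axis k (axis (3 - k) (- w)))"
    (is "improves k x y Q ?Q")
proof -
  interpret sw: greedy_stage "\<lambda>x y. G y x" L d c p "transpose R" by (rule swap_stage)
  have "transpose ?Q = transpose Q + axis k (axis k w) + axis (3 - k) (axis k (- w))"
    by (auto simp: vec_eq_iff transpose_nth axis_nth_if)
  with sw.improve_redirect_demand[of y x "transpose Q" w k] assms
  have "sw.improves k y x (transpose Q) (transpose ?Q)"
    by (simp add: transpose_nth)
  then show ?thesis
    unfolding sw.improves_def improves_def by (simp add: transpose_nth)
qed

lemma improve_uncross: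
  assumes Q: "feasible x y Q" and w: "0 \<le> w"
    and le: "w \<le> Q $ k $ (3 - k)" "w \<le> Q $ (3 - k) $ k"
  shows "improves k x y Q (Q + axis k (axis k w) + axis (3 - k) (axis (3 - k) w)
    + axis k (axis (3 - k) (- w)) + axis (3 - k) (axis k (- w)))" (is "improves k x y Q ?Q")
proof -
  have eq: "unmatched_demand x ?Q = unmatched_demand x Q" "unmatched_supply y ?Q = unmatched_supply y Q"
    by (simp_all add: rematch_simps vec_eq_iff axis_nth_if)
  have f: "feasible x y ?Q"
    using Q w le unfolding feasible_iff eq by (auto simp: axis_nth_if)
  have "(R $ k $ (3 - k) + R $ (3 - k) $ k) * w \<le> (R $ k $ k + R $ (3 - k) $ (3 - k)) * w"
    using perfect_sum w by (rule mult_right_mono)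
  then have "val x y Q \<le> val x y ?Q"
    unfolding stage_value_def eq reward_rematch by (simp add: algebra_simps)
  with f w show ?thesis by (simp add: improves_def axis_nth_if)
qed

text \<open>
  Uncrossing removes one of the two imperfect pairs, unless it already makes type \<open>k\<close> greedy. Then
  one side of type \<open>k\<close> is used by the perfect pair only, so its leftover covers all that is missing.
  The other side is freed from the remaining imperfect pair by redirecting; if that pair is
  exhausted first, unmatched quantities are left on both sides.
\<close>

lemma ex_improvement_greedy_at:
  assumes Q: "feasible x y Q"
  obtains Q' where "improves k x y Q Q'" "Q' $ k $ k = min (x $ k) (y $ k)"
proof -
  define target where "target = min (x $ k) (y $ k)"
  have target_ge: "A $ k $ k \<le> target" if "feasible x y A" for A
    using that by (auto simp: target_def feasible_iff_index[of _ _ _ k])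
  define w1 where "w1 = min (target - Q $ k $ k) (min (Q $ k $ (3 - k)) (Q $ (3 - k) $ k))"
  define Q1 where "Q1 = Q + axis k (axis k w1) + axis (3 - k) (axis (3 - k) w1)
    + axis k (axis (3 - k) (- w1)) + axis (3 - k) (axis k (- w1))"
  have i1: "improves k x y Q Q1"
    unfolding Q1_def using Q target_ge[OF Q]
    by (intro improve_uncross) (auto simp: w1_def feasible_iff)
  then have f1: "feasible x y Q1" by (simp add: improves_def)
  have Q1: "Q1 $ k $ k = Q $ k $ k + w1" "Q1 $ k $ (3 - k) = Q $ k $ (3 - k) - w1"
    "Q1 $ (3 - k) $ k = Q $ (3 - k) $ k - w1"
    by (simp_all add: Q1_def axis_nth_if)
  define w2 where "w2 = min (target - Q1 $ k $ k) (min (unmatched_demand x Q1 $ k) (Q1 $ (3 - k) $ k))"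
  define Q2 where "Q2 = Q1 + axis k (axis k w2) + axis (3 - k) (axis k (- w2))"
  have i2: "improves k x y Q1 Q2"
    unfolding Q2_def using f1 target_ge[OF f1]
    by (intro improve_redirect_demand) (auto simp: w2_def feasible_iff is_state_def)
  then have f2: "feasible x y Q2" by (simp add: improves_def)
  have Q2: "Q2 $ k $ k = Q1 $ k $ k + w2" "Q2 $ k $ (3 - k) = Q1 $ k $ (3 - k)"
    "Q2 $ (3 - k) $ k = Q1 $ (3 - k) $ k - w2"
    by (simp_all add: Q2_def axis_nth_if)
  define w3 where "w3 = min (target - Q2 $ k $ k) (min (unmatched_supply y Q2 $ k) (Q2 $ k $ (3 - k)))"
  define Q3 where "Q3 = Q2 + axis k (axis k w3) + axis k (axis (3 - k) (- w3))"
  have i3: "improves k x y Q2 Q3"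
    unfolding Q3_def using f2 target_ge[OF f2]
    by (intro improve_redirect_supply) (auto simp: w3_def feasible_iff is_state_def)
  then have f3: "feasible x y Q3" by (simp add: improves_def)
  have Q3: "Q3 $ k $ k = Q2 $ k $ k + w3" "Q3 $ k $ (3 - k) = Q2 $ k $ (3 - k) - w3"
    "Q3 $ (3 - k) $ k = Q2 $ (3 - k) $ k"
    by (simp_all add: Q3_def axis_nth_if)
  define w4 where "w4 = target - Q3 $ k $ k"
  have *: "w4 \<le> unmatched_demand x Q3 $ k \<and> w4 \<le> unmatched_supply y Q3 $ k"
    using f1[unfolded feasible_iff_index[of _ _ _ k]] f2[unfolded feasible_iff_index[of _ _ _ k]]
      f3[unfolded feasible_iff_index[of _ _ _ k]]
      Q1 Q2 Q3 w1_def w2_def w3_def target_def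
    unfolding w4_def unmatched_demand_nth unmatched_supply_nth by (smt (verit))
  have "improves k x y Q3 (Q3 + axis k (axis k w4))"
    using f3 * target_ge[OF f3] by (intro improve_pair) (auto simp: w4_def)
  moreover have "(Q3 + axis k (axis k w4)) $ k $ k = min (x $ k) (y $ k)"
    by (simp add: axis_nth_if w4_def target_def)
  ultimately show ?thesis
    using that i1 i2 i3 improves_trans by blast
qed

lemma ex_greedy_improvement:
  assumes "feasible x y Q"
  obtains Q' where "feasible x y Q'" "val x y Q \<le> val x y Q'" "\<And>k. Q' $ k $ k = min (x $ k) (y $ k)"
proof -
  obtain Q1 where Q1: "improves 1 x y Q Q1" "Q1 $ 1 $ 1 = min (x $ 1) (y $ 1)"
    by (rule ex_improvement_greedy_at[OF assms])
  then have "feasible x y Q1" by (simp add: improves_def)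
  from ex_improvement_greedy_at[OF this] obtain Q2
    where Q2: "improves 2 x y Q1 Q2" "Q2 $ 2 $ 2 = min (x $ 2) (y $ 2)" .
  have "Q2 $ 1 $ 1 \<le> min (x $ 1) (y $ 1)"
    using Q2(1) by (auto simp: improves_def feasible_iff_index[of _ _ _ 1])
  with Q1 Q2 have "Q2 $ 1 $ 1 = min (x $ 1) (y $ 1)" by (simp add: improves_def)
  with Q2 have "Q2 $ k $ k = min (x $ k) (y $ k)" for k
    using exhaust_2[of k] by auto
  with Q1(1) Q2(1) that show ?thesis unfolding improves_def by (meson order_trans)
qed

section \<open>The Bellman operator preserves regularity\<close>

lemma bellman_demand_mono:
  assumes "is_state x y" "0 \<le> w"
  shows "bellman R G x y \<le> bellman R G (x + axis k w) y"
proof (rule bellman_leI[OF assms(1)])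
  fix Q assume Q: "feasible x y Q"
  then have f: "feasible (x + axis k w) y Q"
    using assms(2) by (auto simp: feasible_iff unmatched_demand_add is_state_def axis_nth_if)
  have "val x y Q \<le> val (x + axis k w) y Q"
    using Q assms(2) by (simp add: stage_value_def unmatched_demand_add feasible_iff demand_mono)
  also have "\<dots> \<le> bellman R G (x + axis k w) y"
    using f assms by (intro stage_value_le_bellman) (auto simp: is_state_def axis_nth_if)
  finally show "val x y Q \<le> bellman R G (x + axis k w) y" .
qed

text \<open>
  The decision at a state with \<open>w\<close> additional units of type \<open>k\<close> demand has to be imitated without
  them. The lemma attributes these units to the parts of the decision in which they can be thought
  to be used: \<open>b\<close> unmatched, \<open>a\<close> and \<open>a'\<close> matched with each type of supply.
\<close>

lemma split_added_demand:
  assumes "feasible (x + axis k w) y Q" "is_state x y" "0 \<le> w"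
  obtains a a' b where "0 \<le> a" "0 \<le> a'" "0 \<le> b" "a + a' + b = w"
    "a \<le> Q $ k $ k" "a' \<le> Q $ k $ (3 - k)" "b \<le> unmatched_demand (x + axis k w) Q $ k"
proof -
  define b where "b = min w (unmatched_demand (x + axis k w) Q $ k)"
  define a where "a = min (w - b) (Q $ k $ k)"
  have "0 \<le> x $ k" using assms(2) by (simp add: is_state_def)
  then have "0 \<le> a" "0 \<le> w - b - a" "0 \<le> b" "a \<le> Q $ k $ k" "w - b - a \<le> Q $ k $ (3 - k)"
    "b \<le> unmatched_demand (x + axis k w) Q $ k"
    using assms(1,3) unfolding feasible_iff_index[of _ _ _ k] a_def b_def unmatched_demand_nth
    by (auto simp: axis_nth_if)
  then show ?thesis using that[of a "w - b - a" b] by simp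
qed

text \<open>
  Cancelling the matches of the additional units loses their rewards and frees supply, which does
  no harm by monotonicity.
\<close>

lemma bellman_demand_lipschitz:
  assumes st: "is_state x y" and w: "0 \<le> w" and K: "L \<le> K" "\<And>i j. \<bar>R $ i $ j\<bar> \<le> K"
  shows "bellman R G (x + axis k w) y \<le> bellman R G x y + K * w"
proof (rule bellman_leI)
  show "is_state (x + axis k w) y" using st w by (auto simp: is_state_def axis_nth_if)
  fix Q assume Q: "feasible (x + axis k w) y Q"
  from split_added_demand[OF Q st w] obtain a a' b where ab:
    "0 \<le> a" "0 \<le> a'" "0 \<le> b" "a + a' + b = w"
    "a \<le> Q $ k $ k" "a' \<le> Q $ k $ (3 - k)" "b \<le> unmatched_demand (x + axis k w) Q $ k" .
  define Q' where "Q' = Q + axis k (axis k (- a)) + axis k (axis (3 - k) (- a'))"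
  let ?u = "unmatched_demand (x + axis k w) Q" and ?v = "unmatched_supply y Q"
  have u: "unmatched_demand x Q' + axis k b = ?u"
    using ab(4) by (auto simp: Q'_def rematch_simps vec_eq_iff axis_nth_if)
  have v: "unmatched_supply y Q' = ?v + axis k a + axis (3 - k) a'"
    by (simp add: Q'_def rematch_simps)
  have u': "unmatched_demand x Q' = ?u + axis k (- b)"
    unfolding u[symmetric] by (simp add: vec_eq_iff axis_nth_if)
  have f: "feasible x y Q'"
    using Q ab unfolding feasible_iff u' v
    by (auto simp: Q'_def is_state_def axis_nth_if all_index_iff[of _ k])
  have st': "is_state (unmatched_demand x Q') ?v" "is_state ?u ?v"
    "is_state (unmatched_demand x Q') (?v + axis k a)"
    using f Q ab unfolding feasible_iff is_state_def by (auto simp: axis_nth_if)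
  have "G ?u ?v \<le> G (unmatched_demand x Q') ?v + L * b"
    using demand_lipschitz[OF st'(1) ab(3), of k] by (simp add: u)
  also have "\<dots> \<le> G (unmatched_demand x Q') (unmatched_supply y Q') + L * b"
    using supply_mono[OF st'(1) ab(1), of k] supply_mono[OF st'(3) ab(2), of "3 - k"]
    by (simp add: v)
  also have "L * b \<le> K * b"
    using K(1) ab(3) by (rule mult_right_mono)
  finally have "G ?u ?v \<le> G (unmatched_demand x Q') (unmatched_supply y Q') + K * b" by simp
  moreover have "R $ k $ k * a \<le> K * a" "R $ k $ (3 - k) * a' \<le> K * a'"
    using K(2) ab by (auto intro!: mult_right_mono simp: abs_le_iff)
  then have "reward R Q \<le> reward R Q' + K * (a + a')"
    unfolding Q'_def reward_rematch by (simp add: algebra_simps)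
  ultimately have "val (x + axis k w) y Q \<le> val x y Q' + K * w"
    unfolding stage_value_def ab(4)[symmetric] by (simp add: algebra_simps)
  with stage_value_le_bellman[OF st f, of R]
  show "val (x + axis k w) y Q \<le> bellman R G x y + K * w" by linarith
qed

text \<open>
  In the state with the other type, that type takes over all matches of the additional units; the
  unmatched part is compared by the exchange bound of the continuation value.
\<close>

lemma bellman_demand_exchange:
  assumes st: "is_state x y" and w: "0 \<le> w"
    and e: "c k \<le> e" "\<And>j. R $ k $ j - R $ (3 - k) $ j \<le> e"
  shows "bellman R G (x + axis k w) y \<le> bellman R G (x + axis (3 - k) w) y + e * w"
proof (rule bellman_leI)
  show "is_state (x + axis k w) y" using st w by (auto simp: is_state_def axis_nth_if)
  have st_other: "is_state (x + axis (3 - k) w) y" using st w by (auto simp: is_state_def axis_nth_if)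
  fix Q assume Q: "feasible (x + axis k w) y Q"
  from split_added_demand[OF Q st w] obtain a a' b where ab:
    "0 \<le> a" "0 \<le> a'" "0 \<le> b" "a + a' + b = w"
    "a \<le> Q $ k $ k" "a' \<le> Q $ k $ (3 - k)" "b \<le> unmatched_demand (x + axis k w) Q $ k" .
  define Q' where "Q' = Q + axis k (axis k (- a)) + axis (3 - k) (axis k a)
    + axis k (axis (3 - k) (- a')) + axis (3 - k) (axis (3 - k) a')"
  define u0 where "u0 = unmatched_demand (x + axis k w) Q + axis k (- b)"
  let ?v = "unmatched_supply y Q"
  have u: "unmatched_demand (x + axis k w) Q = u0 + axis k b"
    by (simp add: u0_def vec_eq_iff axis_nth_if)
  have u': "unmatched_demand (x + axis (3 - k) w) Q' = u0 + axis (3 - k) b"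
    using ab(4) by (auto simp: u0_def Q'_def rematch_simps vec_eq_iff axis_nth_if)
  have v': "unmatched_supply y Q' = ?v"
    by (simp add: Q'_def rematch_simps vec_eq_iff axis_nth_if)
  have st0: "is_state u0 ?v"
    using Q ab by (auto simp: feasible_iff u0_def is_state_def axis_nth_if)
  then have f: "feasible (x + axis (3 - k) w) y Q'"
    using Q ab unfolding feasible_iff u' v'
    by (auto simp: Q'_def is_state_def axis_nth_if all_index_iff[of _ k])
  have "c k * b \<le> e * b" using e(1) ab(3) by (rule mult_right_mono)
  with demand_exchange[OF st0 ab(3), of k]
  have "G (u0 + axis k b) ?v \<le> G (u0 + axis (3 - k) b) ?v + e * b" by linarith
  moreover have "(R $ k $ k - R $ (3 - k) $ k) * a \<le> e * a"
    "(R $ k $ (3 - k) - R $ (3 - k) $ (3 - k)) * a' \<le> e * a'"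
    using e(2) ab by (auto intro!: mult_right_mono)
  then have "reward R Q \<le> reward R Q' + e * (a + a')"
    unfolding Q'_def reward_rematch by (simp add: algebra_simps)
  ultimately have "val (x + axis k w) y Q \<le> val (x + axis (3 - k) w) y Q' + e * w"
    unfolding stage_value_def u u' v' unfolding ab(4)[symmetric] by (simp add: algebra_simps)
  with stage_value_le_bellman[OF st_other f, of R]
  show "val (x + axis k w) y Q \<le> bellman R G (x + axis (3 - k) w) y + e * w" by linarith
qed

text \<open>
  A greedy decision matches at least \<open>w\<close> units of the pair \<open>(k, k)\<close>. Cancelling these matches
  together with the additional units leaves all leftovers unchanged and loses exactly
  \<open>R $ k $ k * w\<close>.
\<close>

lemma bellman_pair_bound:
  assumes st: "is_state x y" and w: "0 \<le> w"
  shows "bellman R G (x + axis k w) (y + axis k w) \<le> bellman R G x y + R $ k $ k * w"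
proof (rule bellman_leI)
  show "is_state (x + axis k w) (y + axis k w)" using st w by (auto simp: is_state_def axis_nth_if)
  fix Q assume "feasible (x + axis k w) (y + axis k w) Q"
  then obtain Q1 where Q1: "feasible (x + axis k w) (y + axis k w) Q1"
    "val (x + axis k w) (y + axis k w) Q \<le> val (x + axis k w) (y + axis k w) Q1"
    "Q1 $ k $ k = min ((x + axis k w) $ k) ((y + axis k w) $ k)"
    by (metis ex_greedy_improvement)
  define Q' where "Q' = Q1 + axis k (axis k (- w))"
  have eq: "unmatched_demand x Q' = unmatched_demand (x + axis k w) Q1"
    "unmatched_supply y Q' = unmatched_supply (y + axis k w) Q1"
    by (simp_all add: Q'_def rematch_simps)
  have "w \<le> Q1 $ k $ k"
    using Q1(3) st by (simp add: axis_nth_if is_state_def)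
  then have f: "feasible x y Q'"
    using Q1(1) unfolding feasible_iff eq by (auto simp: Q'_def axis_nth_if)
  have "val (x + axis k w) (y + axis k w) Q1 = val x y Q' + R $ k $ k * w"
    unfolding stage_value_def eq by (simp add: Q'_def reward_rematch)
  with Q1(2) stage_value_le_bellman[OF st f, of R]
  show "val (x + axis k w) (y + axis k w) Q \<le> bellman R G x y + R $ k $ k * w" by linarith
qed

lemma bellman_concave:
  assumes st: "is_state x y" "is_state x' y'" and ab: "0 \<le> a" "0 \<le> b" "a + b = 1"
  shows "a * bellman R G x y + b * bellman R G x' y'
    \<le> bellman R G (a *\<^sub>R x + b *\<^sub>R x') (a *\<^sub>R y + b *\<^sub>R y')"
proof -
  obtain Q where Q: "feasible x y Q" "val x y Q = bellman R G x y"
    by (rule bellman_attained[OF st(1)])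
  obtain Q' where Q': "feasible x' y' Q'" "val x' y' Q' = bellman R G x' y'"
    by (rule bellman_attained[OF st(2)])
  let ?Q = "a *\<^sub>R Q + b *\<^sub>R Q'"
  have "a * val x y Q + b * val x' y' Q' \<le> val (a *\<^sub>R x + b *\<^sub>R x') (a *\<^sub>R y + b *\<^sub>R y') ?Q"
    using concave[of "unmatched_demand x Q" "unmatched_supply y Q"
        "unmatched_demand x' Q'" "unmatched_supply y' Q'" a b] Q(1) Q'(1) ab
    unfolding stage_value_def unmatched_combination
    by (simp add: feasible_iff reward_combination algebra_simps)
  also have "\<dots> \<le> bellman R G (a *\<^sub>R x + b *\<^sub>R x') (a *\<^sub>R y + b *\<^sub>R y')"
    using feasible_combination[OF Q(1) Q'(1) ab(1,2)] st ab
    by (intro stage_value_le_bellman) (auto simp: is_state_def)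
  finally show ?thesis by (simp add: Q(2) Q'(2))
qed

text \<open>
  An exchanged unit is either matched now, at a difference of present rewards, or kept, at the
  exchange bound of the continuation value. The new exchange bounds have to dominate both, and
  this is where the assumptions linking consecutive periods enter.
\<close>

lemma regular_bellman:
  assumes c': "\<And>k. c k \<le> c' k" "\<And>k j. R $ k $ j - R $ (3 - k) $ j \<le> c' k"
    and d': "\<And>k. d k \<le> d' k" "\<And>k i. R $ i $ k - R $ i $ (3 - k) \<le> d' k"
  shows "\<exists>K. regular_value (bellman R G) K c' d' (\<lambda>k. R $ k $ k)"
proof -
  interpret sw: greedy_stage "\<lambda>x y. G y x" L d c p "transpose R" by (rule swap_stage)
  define K where "K = Max (insert L {\<bar>R $ i $ j\<bar> | i j. True})"
  have "finite {\<bar>R $ i $ j\<bar> | i j. True}"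
    using finite_image_set2[of "\<lambda>_. True" "\<lambda>_. True" "\<lambda>i j. \<bar>R $ i $ j\<bar>"] by simp
  then have K: "L \<le> K" "\<bar>R $ i $ j\<bar> \<le> K" for i j
    unfolding K_def by (blast intro: Max_ge)+
  have "regular_value (bellman R G) K c' d' (\<lambda>k. R $ k $ k)"
  proof
    fix x y :: "real^2" and k w assume st: "is_state x y" and w: "0 \<le> (w::real)"
    have st': "is_state y x" using st by (simp add: is_state_commute)
    show "bellman R G x y \<le> bellman R G (x + axis k w) y"
      by (rule bellman_demand_mono[OF st w])
    show "bellman R G (x + axis k w) y \<le> bellman R G x y + K * w"
      by (rule bellman_demand_lipschitz[OF st w K])
    show "bellman R G (x + axis k w) y \<le> bellman R G (x + axis (3 - k) w) y + c' k * w"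
      by (rule bellman_demand_exchange[OF st w c'])
    show "bellman R G x y \<le> bellman R G x (y + axis k w)"
      using sw.bellman_demand_mono[OF st' w] by (simp add: bellman_transpose)
    show "bellman R G x (y + axis k w) \<le> bellman R G x y + K * w"
      using sw.bellman_demand_lipschitz[OF st' w K(1)] K(2)
      by (simp add: bellman_transpose transpose_nth)
    show "bellman R G x (y + axis k w) \<le> bellman R G x (y + axis (3 - k) w) + d' k * w"
      using sw.bellman_demand_exchange[OF st' w d'(1)] d'(2)
      by (simp add: bellman_transpose transpose_nth)
    show "bellman R G (x + axis k w) (y + axis k w) \<le> bellman R G x y + R $ k $ k * w"
      by (rule bellman_pair_bound[OF st w])
  qed (rule bellman_concave)
  then show ?thesis ..
qed

end

section \<open>Expectation over arrivals\<close>

lemma regular_zero: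
  assumes "\<And>k. 0 \<le> c k" "\<And>k. 0 \<le> d k" "\<And>k. 0 \<le> p k"
  shows "regular_value (\<lambda>x y. 0) 0 c d p"
  using assms by unfold_locales auto

locale arrivals = prob_space M for M :: "'m measure" +
  fixes A B :: "'m \<Rightarrow> real^2" and \<alpha> \<beta> :: real
  assumes integrable_A: "integrable M A" and integrable_B: "integrable M B"
    and arrivals_state: "\<And>\<omega>. \<omega> \<in> space M \<Longrightarrow> is_state (A \<omega>) (B \<omega>)"
    and carry_over: "0 \<le> \<alpha>" "\<alpha> \<le> 1" "0 \<le> \<beta>" "\<beta> \<le> 1"
begin

definition expected :: "(real^2 \<Rightarrow> real^2 \<Rightarrow> real) \<Rightarrow> real^2 \<Rightarrow> real^2 \<Rightarrow> real" where
  "expected W u v = expectation (\<lambda>\<omega>. W (\<alpha> *\<^sub>R u + A \<omega>) (\<beta> *\<^sub>R v + B \<omega>))"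

lemma next_state:
  assumes "is_state u v" "\<omega> \<in> space M"
  shows "is_state (\<alpha> *\<^sub>R u + A \<omega>) (\<beta> *\<^sub>R v + B \<omega>)"
  using assms arrivals_state[OF assms(2)] carry_over by (simp add: is_state_def)

text \<open>
  Measurability comes from continuity on the set of states, to which the next state always
  belongs, and integrability from the linear growth of a Lipschitz function.
\<close>

lemma integrable_next_value:
  assumes "regular_value W L c d p" "is_state u v"
  shows "integrable M (\<lambda>\<omega>. W (\<alpha> *\<^sub>R u + A \<omega>) (\<beta> *\<^sub>R v + B \<omega>))"
proof -
  interpret regular_value W L c d p by fact
  have meas: "A \<in> borel_measurable M" "B \<in> borel_measurable M"
    using integrable_A integrable_B by auto
  let ?f = "\<lambda>\<omega>. (\<alpha> *\<^sub>R u + A \<omega>, \<beta> *\<^sub>R v + B \<omega>)"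
  have "?f \<in> measurable M (restrict_space borel {(x, y). is_state x y})"
    using next_state[OF assms(2)] meas by (intro measurable_restrict_space2) auto
  from measurable_compose[OF this borel_measurable_continuous_on_restrict[OF continuous_on_states]]
  have m: "(\<lambda>\<omega>. W (\<alpha> *\<^sub>R u + A \<omega>) (\<beta> *\<^sub>R v + B \<omega>)) \<in> borel_measurable M" by simp
  have "integrable M (\<lambda>\<omega>. \<bar>W 0 0\<bar> + L * (2 * norm (\<alpha> *\<^sub>R u + A \<omega>) + 2 * norm (\<beta> *\<^sub>R v + B \<omega>)))"
    using integrable_A integrable_B by (intro integrable_norm Bochner_Integration.integrable_add integrable_mult_right) auto
  moreover have "AE \<omega> in M. norm (W (\<alpha> *\<^sub>R u + A \<omega>) (\<beta> *\<^sub>R v + B \<omega>))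
      \<le> norm (\<bar>W 0 0\<bar> + L * (2 * norm (\<alpha> *\<^sub>R u + A \<omega>) + 2 * norm (\<beta> *\<^sub>R v + B \<omega>)))"
    using order_trans[OF growth_bound[OF next_state[OF assms(2)]] abs_ge_self]
    by (intro AE_I2) simp
  ultimately show ?thesis
    using m by (blast intro: Bochner_Integration.integrable_bound)
qed

lemma expected_le:
  assumes W: "regular_value W L c d p" and st: "is_state u v" "is_state u' v'"
    and le: "\<And>\<omega>. \<omega> \<in> space M \<Longrightarrow> W (\<alpha> *\<^sub>R u + A \<omega>) (\<beta> *\<^sub>R v + B \<omega>)
      \<le> W (\<alpha> *\<^sub>R u' + A \<omega>) (\<beta> *\<^sub>R v' + B \<omega>) + C"
  shows "expected W u v \<le> expected W u' v' + C"
proof -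
  have "expected W u v \<le> expectation (\<lambda>\<omega>. W (\<alpha> *\<^sub>R u' + A \<omega>) (\<beta> *\<^sub>R v' + B \<omega>) + C)"
    unfolding expected_def using integrable_next_value[OF W] st le by (intro integral_mono) auto
  also have "\<dots> = expected W u' v' + C"
    unfolding expected_def using integrable_next_value[OF W st(2)]
    by (simp add: Bochner_Integration.integral_add prob_space)
  finally show ?thesis .
qed

lemma swap_arrivals: "arrivals M B A \<beta> \<alpha>"
  using integrable_A integrable_B arrivals_state carry_over
  by unfold_locales (auto simp: is_state_commute)

lemma expected_swap: "arrivals.expected M B A \<beta> \<alpha> (\<lambda>x y. W y x) v u = expected W u v"
  unfolding arrivals.expected_def[OF swap_arrivals] expected_def ..

lemma shift_arrival: "a *\<^sub>R (u + axis k w) + (e::real^2) = a *\<^sub>R u + e + axis k (a * w)"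
  by (auto simp: vec_eq_iff axis_nth_if algebra_simps)

text \<open>
  Of \<open>w\<close> additional units only \<open>\<alpha> * w\<close> are carried over, so bounds with nonnegative constants
  survive.
\<close>

lemma expected_demand_change:
  assumes W: "regular_value W L c d p" and st: "is_state u v" and w: "0 \<le> w" and c: "\<And>k. 0 \<le> c k"
  shows "expected W u v \<le> expected W (u + axis k w) v"
    and "expected W (u + axis k w) v \<le> expected W u v + L * w"
    and "expected W (u + axis k w) v \<le> expected W (u + axis (3 - k) w) v + c k * w"
proof -
  interpret regular_value W L c d p by fact
  have st': "is_state (u + axis j w) v" for j
    using st w by (auto simp: is_state_def axis_nth_if)
  have aw: "0 \<le> \<alpha> * w" "\<alpha> * w \<le> w"
    using carry_over w by (auto simp: mult_left_le_one_le)
  have scale: "C * (\<alpha> * w) \<le> C * w" if "0 \<le> C" for C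
    using that aw(2) by (simp add: mult_left_mono)
  show "expected W u v \<le> expected W (u + axis k w) v"
    using expected_le[OF W st st'[of k], of 0] demand_mono[OF next_state[OF st] aw(1)]
    by (simp add: shift_arrival)
  show "expected W (u + axis k w) v \<le> expected W u v + L * w"
  proof (rule expected_le[OF W st' st])
    fix \<omega> assume "\<omega> \<in> space M"
    from demand_lipschitz[OF next_state[OF st this] aw(1), of k] scale[OF lipschitz_const_nonneg]
    show "W (\<alpha> *\<^sub>R (u + axis k w) + A \<omega>) (\<beta> *\<^sub>R v + B \<omega>)
      \<le> W (\<alpha> *\<^sub>R u + A \<omega>) (\<beta> *\<^sub>R v + B \<omega>) + L * w"
      unfolding shift_arrival by linarith
  qed
  show "expected W (u + axis k w) v \<le> expected W (u + axis (3 - k) w) v + c k * w"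
  proof (rule expected_le[OF W st' st'])
    fix \<omega> assume "\<omega> \<in> space M"
    from demand_exchange[OF next_state[OF st this] aw(1), of k] scale[OF c]
    show "W (\<alpha> *\<^sub>R (u + axis k w) + A \<omega>) (\<beta> *\<^sub>R v + B \<omega>)
      \<le> W (\<alpha> *\<^sub>R (u + axis (3 - k) w) + A \<omega>) (\<beta> *\<^sub>R v + B \<omega>) + c k * w"
      unfolding shift_arrival by (meson add_left_mono order_trans)
  qed
qed

text \<open>
  Demand and supply are carried over at different rates. Raising both to the larger rate restores
  an additional pair and does not decrease the value.
\<close>

lemma expected_pair_bound:
  assumes W: "regular_value W L c d p" and st: "is_state u v" and w: "0 \<le> w"
    and p': "max \<alpha> \<beta> * p k \<le> p' k"
  shows "expected W (u + axis k w) (v + axis k w) \<le> expected W u v + p' k * w"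
proof (rule expected_le[OF W _ st])
  interpret regular_value W L c d p by fact
  show "is_state (u + axis k w) (v + axis k w)"
    using st w by (auto simp: is_state_def axis_nth_if)
  fix \<omega> assume "\<omega> \<in> space M"
  define X Y m where "X = \<alpha> *\<^sub>R u + A \<omega>" and "Y = \<beta> *\<^sub>R v + B \<omega>" and "m = max \<alpha> \<beta>"
  have XY: "is_state X Y" unfolding X_def Y_def by (rule next_state[OF st]) fact
  have ge: "0 \<le> \<alpha> * w" "0 \<le> \<beta> * w" "0 \<le> m * w" "0 \<le> (m - \<alpha>) * w" "0 \<le> (m - \<beta>) * w"
    using carry_over w by (auto simp: m_def)
  have st2: "is_state (X + axis k (\<alpha> * w)) (Y + axis k (\<beta> * w))"
    "is_state (X + axis k (m * w)) (Y + axis k (\<beta> * w))"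
    using XY ge by (auto simp: is_state_def axis_nth_if)
  have split: "Z + axis k (m * w) = Z + axis k (a * w) + axis k ((m - a) * w)" for Z :: "real^2" and a
    by (simp add: vec_eq_iff axis_nth_if algebra_simps)
  have "W (X + axis k (\<alpha> * w)) (Y + axis k (\<beta> * w)) \<le> W (X + axis k (m * w)) (Y + axis k (\<beta> * w))"
    unfolding split[of X \<alpha>] by (rule demand_mono[OF st2(1) ge(4)])
  also have "\<dots> \<le> W (X + axis k (m * w)) (Y + axis k (m * w))"
    unfolding split[of Y \<beta>] by (rule supply_mono[OF st2(2) ge(5)])
  also have "\<dots> \<le> W X Y + p k * (m * w)"
    by (rule pair_bound[OF XY ge(3)])
  also have "p k * (m * w) \<le> p' k * w"
    using mult_right_mono[OF p' w] by (simp add: m_def algebra_simps)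
  finally show "W (\<alpha> *\<^sub>R (u + axis k w) + A \<omega>) (\<beta> *\<^sub>R (v + axis k w) + B \<omega>)
      \<le> W (\<alpha> *\<^sub>R u + A \<omega>) (\<beta> *\<^sub>R v + B \<omega>) + p' k * w"
    by (simp add: shift_arrival X_def Y_def)
qed

lemma expected_concave:
  assumes W: "regular_value W L c d p" and st: "is_state u v" "is_state u' v'"
    and ab: "0 \<le> a" "0 \<le> b" "a + b = 1"
  shows "a * expected W u v + b * expected W u' v'
    \<le> expected W (a *\<^sub>R u + b *\<^sub>R u') (a *\<^sub>R v + b *\<^sub>R v')"
proof -
  interpret regular_value W L c d p by fact
  have st': "is_state (a *\<^sub>R u + b *\<^sub>R u') (a *\<^sub>R v + b *\<^sub>R v')"
    using st ab by (simp add: is_state_def)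
  have eq: "e *\<^sub>R (a *\<^sub>R z + b *\<^sub>R z') + n = a *\<^sub>R (e *\<^sub>R z + n) + b *\<^sub>R (e *\<^sub>R z' + n)"
    for e and z z' n :: "real^2"
  proof -
    have "n = a *\<^sub>R n + b *\<^sub>R n" by (simp add: ab(3) flip: scaleR_left_distrib)
    then show ?thesis by (simp add: algebra_simps)
  qed
  note int = integrable_next_value[OF W]
  have "a * expected W u v + b * expected W u' v'
    = expectation (\<lambda>\<omega>. a * W (\<alpha> *\<^sub>R u + A \<omega>) (\<beta> *\<^sub>R v + B \<omega>)
        + b * W (\<alpha> *\<^sub>R u' + A \<omega>) (\<beta> *\<^sub>R v' + B \<omega>))"
    unfolding expected_def using int st by simp
  also have "\<dots> \<le> expected W (a *\<^sub>R u + b *\<^sub>R u') (a *\<^sub>R v + b *\<^sub>R v')"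
    unfolding expected_def
  proof (rule integral_mono)
    show "integrable M (\<lambda>\<omega>. a * W (\<alpha> *\<^sub>R u + A \<omega>) (\<beta> *\<^sub>R v + B \<omega>)
        + b * W (\<alpha> *\<^sub>R u' + A \<omega>) (\<beta> *\<^sub>R v' + B \<omega>))"
      using int st by simp
    show "a * W (\<alpha> *\<^sub>R u + A \<omega>) (\<beta> *\<^sub>R v + B \<omega>) + b * W (\<alpha> *\<^sub>R u' + A \<omega>) (\<beta> *\<^sub>R v' + B \<omega>)
      \<le> W (\<alpha> *\<^sub>R (a *\<^sub>R u + b *\<^sub>R u') + A \<omega>) (\<beta> *\<^sub>R (a *\<^sub>R v + b *\<^sub>R v') + B \<omega>)"
      if "\<omega> \<in> space M" for \<omega>
      unfolding eq using next_state that st ab by (intro concave)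
  qed (rule int[OF st'])
  finally show ?thesis .
qed

lemma regular_expected:
  assumes W: "regular_value W L c d p"
    and c: "\<And>k. 0 \<le> c k" and d: "\<And>k. 0 \<le> d k" and p': "\<And>k. max \<alpha> \<beta> * p k \<le> p' k"
  shows "regular_value (expected W) L c d p'"
proof -
  interpret sw: arrivals M B A \<beta> \<alpha> by (rule swap_arrivals)
  show ?thesis
  proof
    fix u v :: "real^2" and k w assume st: "is_state u v" and w: "0 \<le> (w::real)"
    have st': "is_state v u" using st by (simp add: is_state_commute)
    note change = expected_demand_change[OF W st w c]
      sw.expected_demand_change[OF regular_value.swap[OF W] st' w d, unfolded expected_swap]
    show "expected W u v \<le> expected W (u + axis k w) v"
      "expected W (u + axis k w) v \<le> expected W u v + L * w"
      "expected W (u + axis k w) v \<le> expected W (u + axis (3 - k) w) v + c k * w"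
      "expected W u v \<le> expected W u (v + axis k w)"
      "expected W u (v + axis k w) \<le> expected W u v + L * w"
      "expected W u (v + axis k w) \<le> expected W u (v + axis (3 - k) w) + d k * w"
      by (rule change)+
    show "expected W (u + axis k w) (v + axis k w) \<le> expected W u v + p' k * w"
      by (rule expected_pair_bound[OF W st w p'])
  qed (rule expected_concave[OF W])
qed

end

section \<open>Protection levels\<close>

lemma concave_on_min_le:
  fixes h :: "real \<Rightarrow> real"
  assumes "concave_on S h" "s \<in> S" "t \<in> S" "s \<le> z" "z \<le> t"
  shows "min (h s) (h t) \<le> h z"
proof (cases "s = t")
  case False
  define a where "a = (t - z) / (t - s)"
  have a: "0 \<le> a" "0 \<le> 1 - a"
    using assms(4,5) False by (auto simp: a_def field_simps)
  have "a * (t - s) = t - z" using False by (simp add: a_def)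
  then have z: "z = a * s + (1 - a) * t" by (simp add: algebra_simps)
  have "min (h s) (h t) = a * min (h s) (h t) + (1 - a) * min (h s) (h t)"
    by (simp add: algebra_simps)
  also have "\<dots> \<le> a * h s + (1 - a) * h t"
    using a by (intro add_mono mult_left_mono) auto
  also have "\<dots> \<le> h z"
    using assms(1-3) a unfolding concave_on_iff z by auto
  finally show ?thesis .
qed (use assms in auto)

text \<open>
  A maximizer over the half-line is the threshold: it is the best point whenever it is admissible,
  and otherwise the function does not decrease up to the bound \<open>z\<close>. Without a maximizer, the function
  exceeds its maximum over \<open>{l..z}\<close> somewhere beyond \<open>z\<close>, so by concavity \<open>z\<close> is best for every \<open>z\<close>
  and the threshold is infinite.
\<close>

lemma ex_concave_threshold:
  fixes h :: "real \<Rightarrow> real"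
  assumes conc: "concave_on {l..} h" and cont: "continuous_on {l..} h"
  obtains p :: ereal where "ereal l \<le> p"
    "\<And>z m s. l \<le> s \<Longrightarrow> s \<le> z \<Longrightarrow> ereal m = min (ereal z) p \<Longrightarrow> h s \<le> h m"
proof (cases "\<exists>a\<ge>l. \<forall>s\<ge>l. h s \<le> h a")
  case True
  then obtain a where a: "l \<le> a" "\<And>s. l \<le> s \<Longrightarrow> h s \<le> h a" by blast
  have "h s \<le> h m" if "l \<le> s" "s \<le> z" "ereal m = min (ereal z) (ereal a)" for z m s
  proof (cases "a \<le> z")
    case True
    with that a show ?thesis by simp
  next
    case False
    with that a(1) concave_on_min_le[OF conc, of s a z] a(2)[of s] show ?thesis by simp
  qed
  with that[of "ereal a"] a(1) show ?thesis by auto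
next
  case False
  have "h s \<le> h z" if "l \<le> s" "s \<le> z" for z s
  proof -
    have "\<exists>a\<in>{l..z}. \<forall>s\<in>{l..z}. h s \<le> h a"
      using that by (intro continuous_attains_sup continuous_on_subset[OF cont]) auto
    then obtain a where a: "l \<le> a" "a \<le> z" "\<And>s. l \<le> s \<Longrightarrow> s \<le> z \<Longrightarrow> h s \<le> h a" by auto
    from False a(1) obtain t where t: "l \<le> t" "h a < h t" by (metis not_le)
    then have "z < t" using a(3)[of t] by linarith
    with that t concave_on_min_le[OF conc, of s t z] a(3)[of s] show ?thesis by simp
  qed
  with that[of \<infinity>] show ?thesis by auto
qed

context greedy_stage
begin

text \<open>
  The part of the value of a greedy decision that depends on the quantity \<open>s\<close> of type \<open>k\<close> demand
  left after round 2. Supply of the other type is then left in the amount \<open>s - IB\<close>, and every unit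
  that is kept forgoes the reward of the pair \<open>(k, 3 - k)\<close>. Both leftovers are nonnegative exactly
  if \<open>max 0 IB \<le> s\<close>.
\<close>

definition residual_value :: "2 \<Rightarrow> real \<Rightarrow> real \<Rightarrow> real" where
  "residual_value k IB s = G (axis k s) (axis (3 - k) (s - IB)) - R $ k $ (3 - k) * s"

lemma residual_concave: "concave_on {max 0 IB..} (residual_value k IB)"
  unfolding concave_on_iff
proof (intro conjI ballI allI impI)
  fix s t a b :: real assume *: "s \<in> {max 0 IB..}" "t \<in> {max 0 IB..}" "0 \<le> a" "0 \<le> b" "a + b = 1"
  have ax: "a *\<^sub>R axis j s' + b *\<^sub>R axis j t' = (axis j (a * s' + b * t') :: real^2)" for j s' t'
    by (auto simp: vec_eq_iff axis_nth_if)
  have "IB = a * IB + b * IB" using *(5) by (metis distrib_right mult_1)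
  then have ib: "a * (s - IB) + b * (t - IB) = a * s + b * t - IB" by (simp add: algebra_simps)
  have "a * G (axis k s) (axis (3 - k) (s - IB)) + b * G (axis k t) (axis (3 - k) (t - IB))
    \<le> G (axis k (a * s + b * t)) (axis (3 - k) (a * s + b * t - IB))"
    using concave[of "axis k s" "axis (3 - k) (s - IB)" "axis k t" "axis (3 - k) (t - IB)" a b] *
    unfolding ax ib by (simp add: is_state_def axis_nth_if)
  then show "a * residual_value k IB s + b * residual_value k IB t
    \<le> residual_value k IB (a *\<^sub>R s + b *\<^sub>R t)"
    by (simp add: residual_value_def algebra_simps)
qed simp

lemma residual_continuous: "continuous_on {max 0 IB..} (residual_value k IB)"
proof -
  have axis: "continuous_on U (\<lambda>s. axis j (f s) :: real^2)" if "continuous_on U f"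
    for U j and f :: "real \<Rightarrow> real"
  proof -
    have "axis j (f s) = f s *\<^sub>R (axis j 1 :: real^2)" for s
      by (simp add: vec_eq_iff axis_nth_if)
    then show ?thesis using that by (auto intro!: continuous_intros)
  qed
  show ?thesis
    unfolding residual_value_def
    by (intro continuous_intros continuous_on_compose axis)
      (auto simp: is_state_def axis_nth_if)
qed

text \<open>
  In the condition \<open>z\<close> is the demand available for round 2 and \<open>m\<close> what the level \<open>lev\<close> leaves of it.
  The lower bounds on \<open>lev\<close> ensure that \<open>m\<close> is an admissible leftover for the imbalance \<open>IB\<close>.
\<close>

definition protects :: "2 \<Rightarrow> real \<Rightarrow> ereal \<Rightarrow> bool" where
  "protects k IB lev \<longleftrightarrow> 0 \<le> lev \<and> ereal IB \<le> lev \<and>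
     (\<forall>z m s. max 0 IB \<le> s \<longrightarrow> s \<le> z \<longrightarrow> ereal m = min (ereal z) lev \<longrightarrow>
        residual_value k IB s \<le> residual_value k IB m)"

lemma ex_protects: "\<exists>lev. protects k IB lev"
  by (rule ex_concave_threshold[OF residual_concave residual_continuous, of IB k])
    (auto simp: protects_def zero_ereal_def)

text \<open>
  After round 1, type \<open>k\<close> demand and the other type of supply are both left over, so that the pair
  \<open>(k, 3 - k)\<close> can be matched in round 2. Both cases of round 2 are treated together: the first
  is \<open>active 1\<close> and the second \<open>active 2\<close>.
\<close>

definition active :: "2 \<Rightarrow> real^2 \<Rightarrow> real^2 \<Rightarrow> bool" where
  "active k x y \<longleftrightarrow> y $ k < x $ k \<and> x $ (3 - k) < y $ (3 - k)"

text \<open>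
  If type \<open>k\<close> demand or the other type of supply is used up by its perfect partner, nothing is left
  for the pair.
\<close>

lemma cross_zero:
  assumes "feasible x y Q" "\<And>k. Q $ k $ k = min (x $ k) (y $ k)" "\<not> active k x y"
  shows "Q $ k $ (3 - k) = 0"
  using assms(1,3) assms(2)[of k] assms(2)[of "3 - k"]
  by (auto simp: active_def feasible_iff_index[of _ _ _ k] min_def split: if_splits)

lemma greedy_value:
  assumes f: "feasible x y Q" and g: "\<And>k. Q $ k $ k = min (x $ k) (y $ k)" and act: "active k x y"
    and IB: "IB = x $ k + x $ (3 - k) - y $ k - y $ (3 - k)"
  defines "s \<equiv> x $ k - y $ k - Q $ k $ (3 - k)"
  shows "unmatched_demand x Q = axis k s" "unmatched_supply y Q = axis (3 - k) (s - IB)"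
    and "val x y Q = R $ k $ k * y $ k + R $ (3 - k) $ (3 - k) * x $ (3 - k)
      + R $ k $ (3 - k) * (x $ k - y $ k) + residual_value k IB s"
proof -
  have "\<not> active (3 - k) x y" using act by (auto simp: active_def)
  from cross_zero[OF f g this] have c: "Q $ (3 - k) $ k = 0" by simp
  have q: "Q $ k $ k = y $ k" "Q $ (3 - k) $ (3 - k) = x $ (3 - k)"
    using g act by (auto simp: active_def)
  show u: "unmatched_demand x Q = axis k s"
    using c q unmatched_demand_nth[of x Q k] unmatched_demand_nth[of x Q "3 - k"]
    by (simp add: vec_eq_iff all_index_iff[of _ k] axis_nth_if s_def)
  show v: "unmatched_supply y Q = axis (3 - k) (s - IB)"
    using c q unmatched_supply_nth[of y Q k] unmatched_supply_nth[of y Q "3 - k"]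
    by (simp add: vec_eq_iff all_index_iff[of _ k] axis_nth_if s_def IB)
  have "reward R Q = R $ k $ k * y $ k + R $ (3 - k) $ (3 - k) * x $ (3 - k)
    + R $ k $ (3 - k) * (x $ k - y $ k - s)"
    by (simp add: reward_def sum_index[of _ k] c q s_def)
  then show "val x y Q = R $ k $ k * y $ k + R $ (3 - k) $ (3 - k) * x $ (3 - k)
      + R $ k $ (3 - k) * (x $ k - y $ k) + residual_value k IB s"
    unfolding stage_value_def u v residual_value_def by (simp add: algebra_simps)
qed

lemma ex_optimal_active:
  assumes st: "is_state x y" and act: "active k x y"
    and IB: "IB = x $ k + x $ (3 - k) - y $ k - y $ (3 - k)" and lev: "protects k IB lev"
  obtains Q where "feasible x y Q" "\<And>Q'. feasible x y Q' \<Longrightarrow> val x y Q' \<le> val x y Q"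
    "\<And>j. Q $ j $ j = min (x $ j) (y $ j)"
    "ereal (unmatched_demand x Q $ k) = min (ereal (x $ k - y $ k)) lev"
    "ereal (unmatched_supply y Q $ (3 - k)) = min (ereal (y $ (3 - k) - x $ (3 - k))) (lev - ereal IB)"
proof -
  define z where "z = x $ k - y $ k"
  have p_ge: "0 \<le> lev" "ereal IB \<le> lev" using lev by (auto simp: protects_def)
  have z: "max 0 IB < z" using act by (auto simp: z_def IB active_def)
  obtain m where m: "ereal m = min (ereal z) lev" "max 0 IB \<le> m" "m \<le> z"
  proof (cases lev)
    case (real a)
    with p_ge z that[of "min z a"] show ?thesis by (auto simp: min_def)
  qed (use p_ge z that[of z] in auto)
  define Q where "Q = axis k (axis k (y $ k)) + axis (3 - k) (axis (3 - k) (x $ (3 - k)))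
    + axis k (axis (3 - k) (z - m))"
  have Q: "Q $ k $ k = y $ k" "Q $ (3 - k) $ (3 - k) = x $ (3 - k)" "Q $ k $ (3 - k) = z - m"
    "Q $ (3 - k) $ k = 0"
    by (simp_all add: Q_def axis_nth_if)
  have g: "Q $ j $ j = min (x $ j) (y $ j)" for j
  proof -
    have "\<forall>j. Q $ j $ j = min (x $ j) (y $ j)"
      using act by (simp add: all_index_iff[of _ k] Q active_def)
    then show ?thesis by blast
  qed
  have f: "feasible x y Q"
    using st m(2,3) unfolding feasible_iff_index[of _ _ _ k] is_state_iff[of _ _ k] Q
    by (auto simp: z_def IB)
  note val = greedy_value[OF _ _ act IB]
  have s: "x $ k - y $ k - Q $ k $ (3 - k) = m" by (simp add: Q z_def)
  have max: "val x y Q' \<le> val x y Q" if Q': "feasible x y Q'" for Q'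
  proof -
    obtain Q1 where Q1: "feasible x y Q1" "val x y Q' \<le> val x y Q1"
      "\<And>k. Q1 $ k $ k = min (x $ k) (y $ k)"
      using ex_greedy_improvement[OF Q'] by blast
    define s1 where "s1 = x $ k - y $ k - Q1 $ k $ (3 - k)"
    have "s1 \<le> z"
      using Q1(1) by (simp add: s1_def z_def feasible_iff_index[of _ _ _ k])
    moreover have "max 0 IB \<le> s1"
      using Q1(1) val(1,2)[OF Q1(1,3)] unfolding s1_def[symmetric] feasible_iff
      by (simp add: is_state_iff[of _ _ k] axis_nth_if)
    ultimately have "residual_value k IB s1 \<le> residual_value k IB m"
      using lev m(1) by (auto simp: protects_def)
    then have "val x y Q1 \<le> val x y Q"
      unfolding val(3)[OF Q1(1,3)] val(3)[OF f g] s s1_def[symmetric] by simp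
    with Q1(2) show ?thesis by linarith
  qed
  have "ereal (m - IB) = min (ereal (z - IB)) (lev - ereal IB)"
    using m(1) by (cases lev) (auto simp: min_def split: if_splits)
  moreover have "z - IB = y $ (3 - k) - x $ (3 - k)" by (simp add: z_def IB)
  ultimately show ?thesis
    using that[OF f max g] val(1,2)[OF f g] m(1) unfolding s by (simp add: axis_nth_if z_def)
qed

lemma ex_protected_optimum:
  assumes st: "is_state x y" and lev: "\<And>k. protects k IB (lev k)"
    and IB: "IB = x $ 1 + x $ 2 - y $ 1 - y $ 2"
  shows "\<exists>Q. is_arg_max (val x y) (feasible x y) Q \<and>
    (\<forall>k. Q $ k $ k = min (x $ k) (y $ k) \<and>
      (\<not> active k x y \<longrightarrow> Q $ k $ (3 - k) = 0) \<and>
      (active k x y \<longrightarrow>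
        ereal (unmatched_demand x Q $ k) = min (ereal (x $ k - y $ k)) (lev k) \<and>
        ereal (unmatched_supply y Q $ (3 - k))
          = min (ereal (y $ (3 - k) - x $ (3 - k))) (lev k - ereal IB)))"
proof (cases "\<exists>k. active k x y")
  case True
  then obtain k where act: "active k x y" ..
  have IB_k: "IB = x $ k + x $ (3 - k) - y $ k - y $ (3 - k)"
    using exhaust_2[of k] by (auto simp: IB)
  from act have unique: "active j x y \<Longrightarrow> j = k" for j
    using exhaust_2[of k] exhaust_2[of j] by (auto simp: active_def)
  obtain Q where Q: "feasible x y Q" "\<And>Q'. feasible x y Q' \<Longrightarrow> val x y Q' \<le> val x y Q"
    "\<And>j. Q $ j $ j = min (x $ j) (y $ j)"
    "ereal (unmatched_demand x Q $ k) = min (ereal (x $ k - y $ k)) (lev k)"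
    "ereal (unmatched_supply y Q $ (3 - k)) = min (ereal (y $ (3 - k) - x $ (3 - k))) (lev k - ereal IB)"
    using ex_optimal_active[OF st act IB_k lev] by blast
  have "is_arg_max (val x y) (feasible x y) Q"
    using Q(1,2) by (simp add: is_arg_max_linorder)
  moreover have "Q $ j $ (3 - j) = 0" if "\<not> active j x y" for j
    by (rule cross_zero[OF Q(1,3) that])
  moreover have "ereal (unmatched_demand x Q $ j) = min (ereal (x $ j - y $ j)) (lev j) \<and>
    ereal (unmatched_supply y Q $ (3 - j)) = min (ereal (y $ (3 - j) - x $ (3 - j))) (lev j - ereal IB)"
    if "active j x y" for j
    unfolding unique[OF that] using Q(4,5) by (rule conjI)
  ultimately show ?thesis using Q(3) by blast
next
  case False
  obtain Q0 where Q0: "feasible x y Q0" "\<And>Q'. feasible x y Q' \<Longrightarrow> val x y Q' \<le> val x y Q0"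
    using ex_max_stage_value[OF st] by blast
  obtain Q where Q: "feasible x y Q" "val x y Q0 \<le> val x y Q"
    "\<And>k. Q $ k $ k = min (x $ k) (y $ k)"
    using ex_greedy_improvement[OF Q0(1)] by blast
  have "is_arg_max (val x y) (feasible x y) Q"
    unfolding is_arg_max_linorder using Q Q0(2) by (meson order_trans)
  with Q False cross_zero show ?thesis by blast
qed

end

section \<open>The horizontal model\<close>

context horizontal_model
begin

text \<open>
  What a perfect match of type \<open>k\<close> earns in period \<open>t\<close> beyond an imperfect match that uses the
  demand, respectively the supply, of the other type. These are the exchange bounds that greedy
  matching in period \<open>t\<close> needs for the value of period \<open>Suc t\<close>.
\<close>

definition demand_advantage :: "nat \<Rightarrow> 2 \<Rightarrow> real" where
  "demand_advantage t k = r t $ k $ k - r t $ (3 - k) $ k"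

definition supply_advantage :: "nat \<Rightarrow> 2 \<Rightarrow> real" where
  "supply_advantage t k = r t $ k $ k - r t $ k $ (3 - k)"

definition continuation :: "nat \<Rightarrow> real^2 \<Rightarrow> real^2 \<Rightarrow> real" where
  "continuation t u v = expectation
     (\<lambda>\<omega>. V (Suc t) (\<alpha> *\<^sub>R u + D (Suc t) \<omega>) (\<beta> *\<^sub>R v + S (Suc t) \<omega>))"

lemma objective_eq: "objective (V (Suc t)) t = stage_value (r t) (continuation t)"
  by (simp add: fun_eq_iff objective_def stage_value_def reward_def continuation_def)

lemma V_eq_bellman: "t \<in> {1..T} \<Longrightarrow> V t = bellman (r t) (continuation t)"
  by (subst V.simps) (auto simp: fun_eq_iff bellman_def objective_eq)

lemma V_terminal: "V (Suc T) = (\<lambda>x y. 0)"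
  by (subst V.simps) simp

lemma advantage_nonneg: "t \<in> {1..T} \<Longrightarrow> 0 \<le> demand_advantage t k" "t \<in> {1..T} \<Longrightarrow> 0 \<le> supply_advantage t k"
  using perfect_pair[of t k] by (auto simp: demand_advantage_def supply_advantage_def)

text \<open>
  In the last period the continuation value vanishes. The bound for pairs is then the
  nonnegativity of \<open>r T $ k $ k\<close>, which is the condition on waiting for the reward \<open>r (Suc T) = 0\<close>.
\<close>

lemma stage_greedy:
  assumes t: "t \<in> {1..T}" and wait: "waiting_not_profitable T \<alpha> \<beta> r"
    and V: "regular_value (V (Suc t)) L (demand_advantage t) (supply_advantage t) (\<lambda>k. r (Suc t) $ k $ k)"
  shows "\<exists>L. greedy_stage (continuation t) L (demand_advantage t) (supply_advantage t)
    (\<lambda>k. r t $ k $ k) (r t)"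
proof -
  have w: "max \<alpha> \<beta> * r (Suc t) $ k $ k \<le> r t $ k $ k" for k
    using wait t by (simp add: waiting_not_profitable_def)
  note nonneg = advantage_nonneg[OF t]
  have "\<exists>L. regular_value (continuation t) L (demand_advantage t) (supply_advantage t) (\<lambda>k. r t $ k $ k)"
  proof (cases "t = T")
    case True
    then have "continuation t = (\<lambda>u v. 0)" by (simp add: fun_eq_iff continuation_def V_terminal)
    moreover have "0 \<le> r t $ k $ k" for k
      using w[of k] True by (simp add: reward_terminal)
    ultimately show ?thesis
      using regular_zero[of "demand_advantage t" "supply_advantage t" "\<lambda>k. r t $ k $ k"] nonneg by auto
  next
    case False
    then have t': "Suc t \<in> {1..T}" using t by auto
    interpret ar: arrivals M "D (Suc t)" "S (Suc t)" \<alpha> \<beta>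
      using D_integrable[OF t'] S_integrable[OF t'] arrivals_nonneg[OF t'] alpha_range beta_range
      by unfold_locales auto
    have "continuation t = ar.expected (V (Suc t))"
      by (simp add: fun_eq_iff continuation_def ar.expected_def)
    with ar.regular_expected[OF V nonneg w] show ?thesis by auto
  qed
  then obtain L where
    "regular_value (continuation t) L (demand_advantage t) (supply_advantage t) (\<lambda>k. r t $ k $ k)" ..
  then interpret regular_value "continuation t" L "demand_advantage t" "supply_advantage t" "\<lambda>k. r t $ k $ k" .
  have "r t $ k $ (3 - k) + r t $ (3 - k) $ k \<le> r t $ k $ k + r t $ (3 - k) $ (3 - k)" for k
    using perfect_pair[OF t, of k] perfect_pair[OF t, of "3 - k"] by simp
  then show ?thesis
    by (intro exI[of _ L]) (unfold_locales, auto simp: demand_advantage_def supply_advantage_def)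
qed

text \<open>
  Backward induction: regularity of the value function of the next period gives greedy matching
  in this period, and thereby the regularity of its value function.
\<close>

lemma ex_greedy_stage:
  assumes t: "t \<in> {1..T}" and wait: "waiting_not_profitable T \<alpha> \<beta> r"
  shows "\<exists>L. greedy_stage (continuation t) L (demand_advantage t) (supply_advantage t)
    (\<lambda>k. r t $ k $ k) (r t)"
proof -
  have "t \<le> T" using t by simp
  then have "\<exists>L. regular_value (V (Suc t)) L (demand_advantage t) (supply_advantage t)
    (\<lambda>k. r (Suc t) $ k $ k)"
  proof (induction rule: inc_induct)
    case base
    show ?case
      using regular_zero[of "demand_advantage T" "supply_advantage T" "\<lambda>k. r (Suc T) $ k $ k"]
        advantage_nonneg[of T] T_ge_1 by (auto simp: V_terminal reward_terminal)
  next
    case (step n)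
    then have n: "n \<in> {1..T}" "Suc n \<in> {1..T}" using t by auto
    from step.IH stage_greedy[OF n(2) wait] obtain L where
      "greedy_stage (continuation (Suc n)) L (demand_advantage (Suc n)) (supply_advantage (Suc n))
        (\<lambda>k. r (Suc n) $ k $ k) (r (Suc n))" by blast
    then interpret greedy_stage "continuation (Suc n)" L "demand_advantage (Suc n)"
      "supply_advantage (Suc n)" "\<lambda>k. r (Suc n) $ k $ k" "r (Suc n)" .
    show ?case
      unfolding V_eq_bellman[OF n(2)]
    proof (rule regular_bellman)
      fix k j
      show "demand_advantage (Suc n) k \<le> demand_advantage n k"
        "r (Suc n) $ k $ j - r (Suc n) $ (3 - k) $ j \<le> demand_advantage n k"
        "supply_advantage (Suc n) k \<le> supply_advantage n k"
        "r (Suc n) $ j $ k - r (Suc n) $ j $ (3 - k) \<le> supply_advantage n k"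
        using horizontal_model.demand_exchange[OF horizontal_model_axioms n(1)]
          horizontal_model.supply_exchange[OF horizontal_model_axioms n(1)]
        by (auto simp: demand_advantage_def supply_advantage_def)
    qed
  qed
  then show ?thesis using stage_greedy[OF t wait] by blast
qed

end

lemma protection_levels_shift:
  assumes "- \<infinity> < p"
  shows "protection_levels p (p - ereal IB) IB"
  using assms by (cases p) (auto simp: protection_levels_def)

theorem proposition3:
  fixes M :: "'m measure" and T :: nat and \<alpha> \<beta> :: real
    and r :: "nat \<Rightarrow> real^2^2" and D S :: "nat \<Rightarrow> 'm \<Rightarrow> real^2"
  assumes "horizontal_model M T \<alpha> \<beta> r D S"
    and "waiting_not_profitable T \<alpha> \<beta> r"
  shows "\<exists>(Q :: nat \<Rightarrow> real^2 \<Rightarrow> real^2 \<Rightarrow> real^2^2)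
            (pd_plus :: nat \<Rightarrow> real \<Rightarrow> ereal) (ps_plus :: nat \<Rightarrow> real \<Rightarrow> ereal)
            (pd_minus :: nat \<Rightarrow> real \<Rightarrow> ereal) (ps_minus :: nat \<Rightarrow> real \<Rightarrow> ereal).
      matching_model.optimal_policy M T \<alpha> \<beta> r D S Q \<and>
      (\<forall>t\<in>{1..T}. \<forall>IB.
         protection_levels (pd_plus t IB) (ps_plus t IB) IB \<and>
         protection_levels (pd_minus t IB) (ps_minus t IB) IB) \<and>
      (\<forall>t\<in>{1..T}. \<forall>x y. is_state x y \<longrightarrow>
        (let z1 = excess_demand1 x y; z2 = excess_supply2 x y; IB = z1 - z2;
             q = Q t x y; u = unmatched_demand x q; v = unmatched_supply y q
         in (\<forall>k. q $ k $ k = min (x $ k) (y $ k)) \<and>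
            (z1 * z2 \<le> 0 \<longrightarrow> q $ 1 $ 2 = 0 \<and> q $ 2 $ 1 = 0) \<and>
            (z1 > 0 \<and> z2 > 0 \<longrightarrow> q $ 2 $ 1 = 0 \<and>
               ereal (u $ 1) = min (ereal z1) (pd_plus t IB) \<and>
               ereal (v $ 2) = min (ereal z2) (ps_plus t IB)) \<and>
            (z1 < 0 \<and> z2 < 0 \<longrightarrow> q $ 1 $ 2 = 0 \<and>
               ereal (u $ 2) = min (ereal (- z2)) (pd_minus t IB) \<and>
               ereal (v $ 1) = min (ereal (- z1)) (ps_minus t IB))))"
proof -
  interpret horizontal_model M T \<alpha> \<beta> r D S by fact
  have other: "(3::2) - 1 = 2" "(3::2) - 2 = 1" by simp_all
  define P where "P t k IB = (SOME p. greedy_stage.protects (continuation t) (r t) k IB p)" for t k IB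
  define good where "good t x y q \<longleftrightarrow>
    is_arg_max (objective (V (Suc t)) t x y) (feasible x y) q \<and>
    (let z1 = excess_demand1 x y; z2 = excess_supply2 x y; IB = z1 - z2;
             u = unmatched_demand x q; v = unmatched_supply y q
         in (\<forall>k. q $ k $ k = min (x $ k) (y $ k)) \<and>
            (z1 * z2 \<le> 0 \<longrightarrow> q $ 1 $ 2 = 0 \<and> q $ 2 $ 1 = 0) \<and>
            (z1 > 0 \<and> z2 > 0 \<longrightarrow> q $ 2 $ 1 = 0 \<and>
               ereal (u $ 1) = min (ereal z1) (P t 1 IB) \<and>
               ereal (v $ 2) = min (ereal z2) (P t 1 IB - ereal IB)) \<and>
            (z1 < 0 \<and> z2 < 0 \<longrightarrow> q $ 1 $ 2 = 0 \<and>
               ereal (u $ 2) = min (ereal (- z2)) (P t 2 IB) \<and>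
               ereal (v $ 1) = min (ereal (- z1)) (P t 2 IB - ereal IB)))" for t x y q
  define Q where "Q t x y = (SOME q. good t x y q)" for t x y
  have stage: "(\<forall>k IB. - \<infinity> < P t k IB) \<and> (\<forall>x y. is_state x y \<longrightarrow> good t x y (Q t x y))"
    if t: "t \<in> {1..T}" for t
  proof -
    from ex_greedy_stage[OF t assms(2)] obtain L where
      "greedy_stage (continuation t) L (demand_advantage t) (supply_advantage t) (\<lambda>k. r t $ k $ k) (r t)" ..
    then interpret greedy_stage "continuation t" L "demand_advantage t" "supply_advantage t"
      "\<lambda>k. r t $ k $ k" "r t" .
    have P: "protects k IB (P t k IB)" for k IB
      unfolding P_def by (rule someI_ex[OF ex_protects])
    have "- \<infinity> < P t k IB" for k IB
      using P[of k IB] unfolding protects_def by (cases "P t k IB") auto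
    moreover have "good t x y (Q t x y)" if st: "is_state x y" for x y
      unfolding Q_def
    proof (rule someI_ex)
      define IB where "IB = x $ 1 + x $ 2 - y $ 1 - y $ 2"
      have z: "excess_demand1 x y - excess_supply2 x y = IB"
        by (simp add: IB_def excess_demand1_def excess_supply2_def)
      from ex_protected_optimum[OF st P IB_def] obtain q where
        q: "is_arg_max (objective (V (Suc t)) t x y) (feasible x y) q"
        and g: "\<And>k. q $ k $ k = min (x $ k) (y $ k)"
        and zero: "\<And>k. \<not> active k x y \<Longrightarrow> q $ k $ (3 - k) = 0"
        and prot: "\<And>k. active k x y \<Longrightarrow>
          ereal (unmatched_demand x q $ k) = min (ereal (x $ k - y $ k)) (P t k IB) \<and>
          ereal (unmatched_supply y q $ (3 - k))
            = min (ereal (y $ (3 - k) - x $ (3 - k))) (P t k IB - ereal IB)"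
        unfolding objective_eq by blast
      have "good t x y q"
        using q g zero[of 1] zero[of 2] prot[of 1] prot[of 2]
        unfolding good_def Let_def z other active_def
        by (auto simp: excess_demand1_def excess_supply2_def mult_le_0_iff)
      then show "\<exists>q. good t x y q" ..
    qed
    ultimately show ?thesis by blast
  qed
  show ?thesis
    by (rule exI[of _ Q], rule exI[of _ "\<lambda>t. P t 1"], rule exI[of _ "\<lambda>t IB. P t 1 IB - ereal IB"],
        rule exI[of _ "\<lambda>t. P t 2"], rule exI[of _ "\<lambda>t IB. P t 2 IB - ereal IB"])
      (use stage protection_levels_shift in \<open>auto simp: optimal_policy_def good_def Let_def\<close>)
qed

end
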